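(* Let $k\ge 3$ and let $P$ be a locally finite poset. Then the following implications hold for $P$: (a) (VT), (D$k^-$C), (D$k$MD), and (NTC) imply (NOD$k^-$). (b) (D$k^-$CF) and (UC$k$) imply (D$k^-$C) and (D$k$MF). (c) (D$k^-$CF) and (D$k$MD) imply (NOD$k^-$). (d) If (D$h^-$CF) and (NOD$h^-$) hold for all $3\le h\le k$, then (D$k$MD) holds. (e) If (D$h$MF) and (NOD$h^-$) hold for all $3\le h\le k$, then (D$k$MD) holds. (f) If (D$h^-$CF) holds for all $3\le h\le k$ and (NOD$k^-$) holds, then (UC$k$) and (D$k$MF) hold.
   Context: All posets are locally finite (every closed interval is finite). Write $x\rightarrow y$ when $y$ covers $x$; $\{x,y\}\rightarrow z$ means $x\to z$ and $y\to z$; $w\to\{x,y\}$ means $w\to x$ and $w\to y$. For $k\ge 3$, $d_k(1)$ is the $(2k-2)$-element poset $\{a_k,\dots,a_3;b,c;f_3,\dots,f_k\}$ with covering relations $a_k\to\cdots\to a_3\to\{b,c\}\to f_3\to\cdots\to f_k$. An interval is a $d_k$-interval if it is isomorphic to $d_k(1)$. A convex subset is a $d_k^-$-set if it is isomorphic to $d_k(1)-\{f_k\}$; for $k=3$ this is a set $\{w;x,y\}$ of distinct elements with $w\to\{x,y\}$. For $k\ge4$ a $d_k^-$-set is an interval (a $d_k^-$-interval). A completing element of a $d_k^-$-set $S$ is an element $z$ such that $S\cup\{z\}$ is a $d_k$-interval (with maximum $z$). Two $d_3^-$-sets $\{w;x,y\}$, $\{w';x,y\}$ with $w\ne w'$ overlap.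 For $k\ge4$, if $[w,z']$ is a $d_k^-$-interval in which $u$ is the unique element covering $w$, and $w'\ne w$ is covered by $u$ and $[w',z']$ is also a $d_k^-$-interval, these two overlap. Two $d_k$-intervals are distinct if they differ as sets. Axioms and properties, for $k\ge3$: (VT) $w\to\{x,y\}$ (with $x\ne y$) implies there is $z$ with $\{x,y\}\to z$. (D$k^-$C) for each $d_k^-$-set $S$ there is $z$ such that $S\cup\{z\}$ is a $d_k$-interval. (D$k$MF) the maximum element of each $d_k$-interval covers only elements in that interval. (D$k^-$CF) for each $d_k^-$-set $S$ there is $z$ such that $S\cup\{z\}$ is a $d_k$-interval with maximum $z$ and $z$ covers only elements of $S$. (NOD$k^-$) there do not exist overlapping $d_k^-$-sets. (D$k$MD) the maximum elements of distinct $d_k$-intervals are distinct. (NTC) no element is covered by three (distinct) elements. (UC$k$) each $d_k^-$-set has exactly one completing element. *)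

theory Defs
  imports Main
begin

text \<open>
  A poset is given by its reflexive order relation \<open>r\<close> with \<open>Partial_order r\<close>; the carrier is
  \<open>Field r\<close>. The subposet induced on \<open>S\<close> is \<open>Restr r S\<close>, and posets \<open>r\<close>, \<open>s\<close> are isomorphic
  if \<open>\<exists>f. iso r s f\<close>. The library's \<open>iso\<close> is meant for well-orders, but by \<open>iso_iff2\<close> it is the
  usual notion of isomorphism for arbitrary relations.
\<close>

definition covby :: "'a rel \<Rightarrow> 'a \<Rightarrow> 'a \<Rightarrow> bool" where
  "covby r x y \<longleftrightarrow> (x, y) \<in> r \<and> x \<noteq> y \<and>
     (\<forall>z. (x, z) \<in> r \<and> (z, y) \<in> r \<longrightarrow> z = x \<or> z = y)"

definition interval :: "'a rel \<Rightarrow> 'a \<Rightarrow> 'a \<Rightarrow> 'a set" where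
  "interval r x y = {z. (x, z) \<in> r \<and> (z, y) \<in> r}"

definition locally_finite :: "'a rel \<Rightarrow> bool" where
  "locally_finite r \<longleftrightarrow> (\<forall>x y. finite (interval r x y))"

definition convex_in :: "'a rel \<Rightarrow> 'a set \<Rightarrow> bool" where
  "convex_in r S \<longleftrightarrow> S \<subseteq> Field r \<and> (\<forall>x\<in>S. \<forall>y\<in>S. interval r x y \<subseteq> S)"

definition maximum_of :: "'a rel \<Rightarrow> 'a set \<Rightarrow> 'a \<Rightarrow> bool" where
  "maximum_of r S m \<longleftrightarrow> m \<in> S \<and> (\<forall>x\<in>S. (x, m) \<in> r)"

datatype d_elem = A nat | B | C | F nat

definition d_verts :: "nat \<Rightarrow> d_elem set" where
  "d_verts k = A ` {3..k} \<union> {B, C} \<union> F ` {3..k}"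

definition d_covers :: "nat \<Rightarrow> d_elem rel" where
  "d_covers k = {(A (Suc i), A i) | i. 3 \<le> i \<and> i < k}
     \<union> {(A 3, B), (A 3, C), (B, F 3), (C, F 3)}
     \<union> {(F i, F (Suc i)) | i. 3 \<le> i \<and> i < k}"

text \<open>The poset \<open>d\<^sub>k(1)\<close>, for \<open>k \<ge> 3\<close>.\<close>

definition d_poset :: "nat \<Rightarrow> d_elem rel" where
  "d_poset k = Id_on (d_verts k) \<union> (d_covers k)\<^sup>+"

definition d_interval :: "nat \<Rightarrow> 'a rel \<Rightarrow> 'a set \<Rightarrow> bool" where
  "d_interval k r S \<longleftrightarrow>
     (\<exists>x y. (x, y) \<in> r \<and> S = interval r x y) \<and> (\<exists>f. iso (Restr r S) (d_poset k) f)"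

definition d_minus_set :: "nat \<Rightarrow> 'a rel \<Rightarrow> 'a set \<Rightarrow> bool" where
  "d_minus_set k r S \<longleftrightarrow>
     convex_in r S \<and> (\<exists>f. iso (Restr r S) (Restr (d_poset k) (d_verts k - {F k})) f)"

definition completing :: "nat \<Rightarrow> 'a rel \<Rightarrow> 'a set \<Rightarrow> 'a \<Rightarrow> bool" where
  "completing k r S z \<longleftrightarrow> d_interval k r (S \<union> {z}) \<and> maximum_of r (S \<union> {z}) z"

text \<open>
  For \<open>k = 3\<close> the covering conditions fix the roles of the elements: the sets share the two
  upper elements \<open>x\<close>, \<open>y\<close> and differ in the bottom element.
\<close>

definition overlapping :: "nat \<Rightarrow> 'a rel \<Rightarrow> 'a set \<Rightarrow> 'a set \<Rightarrow> bool" where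
  "overlapping k r S T \<longleftrightarrow> d_minus_set k r S \<and> d_minus_set k r T \<and>
     (if k = 3 then
        \<exists>w w' x y. w \<noteq> w' \<and> x \<noteq> y \<and> S = {w, x, y} \<and> T = {w', x, y} \<and>
          covby r w x \<and> covby r w y \<and> covby r w' x \<and> covby r w' y
      else
        \<exists>w w' u z'. S = interval r w z' \<and> T = interval r w' z' \<and> w \<noteq> w' \<and>
          u \<in> interval r w z' \<and> covby r w u \<and>
          (\<forall>v\<in>interval r w z'. covby r w v \<longrightarrow> v = u) \<and>
          covby r w' u)"

definition VT :: "'a rel \<Rightarrow> bool" where
  "VT r \<longleftrightarrow> (\<forall>w x y. x \<noteq> y \<and> covby r w x \<and> covby r w y \<longrightarrow>
     (\<exists>z. covby r x z \<and> covby r y z))"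

definition DmC :: "nat \<Rightarrow> 'a rel \<Rightarrow> bool" where
  "DmC k r \<longleftrightarrow> (\<forall>S. d_minus_set k r S \<longrightarrow> (\<exists>z. d_interval k r (S \<union> {z})))"

definition DMF :: "nat \<Rightarrow> 'a rel \<Rightarrow> bool" where
  "DMF k r \<longleftrightarrow> (\<forall>S m. d_interval k r S \<and> maximum_of r S m \<longrightarrow>
     (\<forall>x. covby r x m \<longrightarrow> x \<in> S))"

definition DmCF :: "nat \<Rightarrow> 'a rel \<Rightarrow> bool" where
  "DmCF k r \<longleftrightarrow> (\<forall>S. d_minus_set k r S \<longrightarrow>
     (\<exists>z. d_interval k r (S \<union> {z}) \<and> maximum_of r (S \<union> {z}) z \<and>
          (\<forall>x. covby r x z \<longrightarrow> x \<in> S)))"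

definition NODm :: "nat \<Rightarrow> 'a rel \<Rightarrow> bool" where
  "NODm k r \<longleftrightarrow> \<not> (\<exists>S T. overlapping k r S T)"

definition DMD :: "nat \<Rightarrow> 'a rel \<Rightarrow> bool" where
  "DMD k r \<longleftrightarrow> (\<forall>S T m n. d_interval k r S \<and> d_interval k r T \<and> S \<noteq> T \<and>
     maximum_of r S m \<and> maximum_of r T n \<longrightarrow> m \<noteq> n)"

definition NTC :: "'a rel \<Rightarrow> bool" where
  "NTC r \<longleftrightarrow> \<not> (\<exists>x y1 y2 y3. y1 \<noteq> y2 \<and> y1 \<noteq> y3 \<and> y2 \<noteq> y3 \<and>
     covby r x y1 \<and> covby r x y2 \<and> covby r x y3)"

definition UC :: "nat \<Rightarrow> 'a rel \<Rightarrow> bool" where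
  "UC k r \<longleftrightarrow> (\<forall>S. d_minus_set k r S \<longrightarrow> (\<exists>!z. completing k r S z))"

end

theory Submission
  imports Defs
begin

text \<open>
  In (a) and (c), a completing element \<open>z\<close> of one of two overlapping \<open>d\<^sub>k\<^sup>-\<close>-sets also completes
  the other, which contradicts (D\<open>k\<close>MD): in (c) because \<open>z\<close> covers only elements of the first set,
  in (a) because the \<open>A\<close>-elements of a \<open>d\<^sub>k\<^sup>-\<close>-set have no covers outside of it.
  In (e), two \<open>d\<^sub>k\<close>-intervals with the same maximum agree from the top down to the incomparable pair
  by (D\<open>h\<close>MF), and from there down to the minimum by (NOD\<open>h\<^sup>-\<close>).
  The core of (f) is the uniqueness of completing elements. If \<open>z\<^sub>1 \<noteq> z\<^sub>2\<close> complete \<open>S\<close>, then the chain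
  of \<open>S\<close> above its incomparable pair \<open>b, c\<close>, followed by \<open>z\<^sub>1, z\<^sub>2\<close>, is the lower part of a
  \<open>d\<^sub>k\<^sub>-\<^sub>1\<close>-interval whose upper chain is supplied by (D\<open>h\<^sup>-\<close>CF) for \<open>h = 3, \<dots>, k - 1\<close>. Putting
  \<open>b\<close> or \<open>c\<close> below this interval gives two overlapping \<open>d\<^sub>k\<^sup>-\<close>-sets.
  Part (d) follows from (f) and (e).
\<close>

text \<open>
  The vertices of \<open>d\<^sub>k(1)\<close> are \<open>verts k k\<close>, and those of \<open>d\<^sub>k(1) - {f\<^sub>k}\<close> are \<open>verts k (k - 1)\<close>.
\<close>

definition verts :: "nat \<Rightarrow> nat \<Rightarrow> d_elem set" where
  "verts n m = A ` {3..n} \<union> {B, C} \<union> F ` {3..m}"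

lemma mem_verts [simp]:
  "A i \<in> verts n m \<longleftrightarrow> 3 \<le> i \<and> i \<le> n"
  "B \<in> verts n m" "C \<in> verts n m"
  "F i \<in> verts n m \<longleftrightarrow> 3 \<le> i \<and> i \<le> m"
  by (auto simp: verts_def)

lemma verts_mono: "n \<le> n' \<Longrightarrow> m \<le> m' \<Longrightarrow> verts n m \<subseteq> verts n' m'"
  by (auto simp: verts_def)

lemma d_verts_eq: "d_verts k = verts k k"
  by (simp add: d_verts_def verts_def)

lemma d_verts_minus_eq:
  assumes "3 \<le> k" shows "d_verts k - {F k} = verts k (k - 1)"
proof (rule set_eqI)
  fix x show "x \<in> d_verts k - {F k} \<longleftrightarrow> x \<in> verts k (k - 1)"
    using assms by (cases x) (auto simp: d_verts_eq)
qed

lemma verts_insert_top: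
  assumes "3 \<le> k" shows "verts k k = insert (F k) (verts k (k - 1))"
proof (rule set_eqI)
  fix x show "x \<in> verts k k \<longleftrightarrow> x \<in> insert (F k) (verts k (k - 1))"
    using assms by (cases x) auto
qed

section \<open>The order of d_k(1) in closed form\<close>

text \<open>One relation on all of \<open>d_elem\<close> serves every k, so passing to a smaller k
  only shrinks the vertex set. The \<open>A\<close> indices decrease upwards, the \<open>F\<close>
  indices increase.\<close>

fun d_le :: "d_elem \<Rightarrow> d_elem \<Rightarrow> bool" where
  "d_le (A i) (A j) \<longleftrightarrow> j \<le> i"
| "d_le (A i) B \<longleftrightarrow> True"
| "d_le (A i) C \<longleftrightarrow> True"
| "d_le (A i) (F j) \<longleftrightarrow> True"
| "d_le B (A j) \<longleftrightarrow> False"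
| "d_le B B \<longleftrightarrow> True"
| "d_le B C \<longleftrightarrow> False"
| "d_le B (F j) \<longleftrightarrow> True"
| "d_le C (A j) \<longleftrightarrow> False"
| "d_le C B \<longleftrightarrow> False"
| "d_le C C \<longleftrightarrow> True"
| "d_le C (F j) \<longleftrightarrow> True"
| "d_le (F i) (A j) \<longleftrightarrow> False"
| "d_le (F i) B \<longleftrightarrow> False"
| "d_le (F i) C \<longleftrightarrow> False"
| "d_le (F i) (F j) \<longleftrightarrow> i \<le> j"

lemma d_le_refl [simp]: "d_le x x"
  by (cases x) auto

lemma d_le_trans: "d_le x y \<Longrightarrow> d_le y z \<Longrightarrow> d_le x z"
  by (cases x; cases y; cases z) auto

lemma d_le_antisym: "d_le x y \<Longrightarrow> d_le y x \<Longrightarrow> x = y"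
  by (cases x; cases y) auto

lemma d_le_linear: "d_le x y \<or> d_le y x \<or> (x = B \<and> y = C) \<or> (x = C \<and> y = B)"
  by (cases x; cases y) auto

lemma verts_convex:
  assumes "x \<in> verts n m" "z \<in> verts n m" "y \<in> verts n' m'" "3 \<le> n" "d_le x y" "d_le y z"
  shows "y \<in> verts n m"
  using assms by (cases x; cases y; cases z) auto

lemma d_covers_A_chain:
  assumes "3 \<le> j" "j \<le> i" "i \<le> k"
  shows "(A i, A j) \<in> (d_covers k)\<^sup>*"
  using assms(2,3)
proof (induction i rule: dec_induct)
  case (step i)
  then have "(A (Suc i), A i) \<in> d_covers k" using assms by (auto simp: d_covers_def)
  with step show ?case by (auto intro: converse_rtrancl_into_rtrancl)
qed simp

lemma d_covers_F_chain:
  assumes "3 \<le> i" "i \<le> j" "j \<le> k"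
  shows "(F i, F j) \<in> (d_covers k)\<^sup>*"
  using assms(2,3)
proof (induction j rule: dec_induct)
  case (step j)
  then have "(F j, F (Suc j)) \<in> d_covers k" using assms by (auto simp: d_covers_def)
  with step show ?case by (auto intro: rtrancl_into_rtrancl)
qed simp

text \<open>All generating covers satisfy \<open>d_le\<close>, which is transitive. Conversely,
  comparable vertices are joined by covers along the \<open>A\<close> chain, through
  \<open>B\<close> or \<open>C\<close>, and along the \<open>F\<close> chain.\<close>

lemma d_poset_iff:
  assumes k: "3 \<le> k"
  shows "(x, y) \<in> d_poset k \<longleftrightarrow> x \<in> verts k k \<and> y \<in> verts k k \<and> d_le x y"
proof
  have c: "x \<in> verts k k \<and> y \<in> verts k k \<and> d_le x y" if "(x, y) \<in> d_covers k" for x y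
    using that k by (auto simp: d_covers_def)
  have t: "x \<in> verts k k \<and> y \<in> verts k k \<and> d_le x y" if "(x, y) \<in> (d_covers k)\<^sup>+" for x y
    using that
  proof (induction rule: trancl_induct)
    case (base y)
    then show ?case using c by blast
  next
    case (step y z)
    then show ?case using c d_le_trans by blast
  qed
  assume "(x, y) \<in> d_poset k"
  then show "x \<in> verts k k \<and> y \<in> verts k k \<and> d_le x y"
    using t by (auto simp: d_poset_def d_verts_eq)
next
  assume a: "x \<in> verts k k \<and> y \<in> verts k k \<and> d_le x y"
  have s: "(A 3, B) \<in> d_covers k" "(A 3, C) \<in> d_covers k" "(B, F 3) \<in> d_covers k" "(C, F 3) \<in> d_covers k"
    by (auto simp: d_covers_def)
  have AB: "(A i, B) \<in> (d_covers k)\<^sup>*" "(A i, C) \<in> (d_covers k)\<^sup>*" if "3 \<le> i" "i \<le> k" for i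
    using d_covers_A_chain[of 3 i k] that s by (auto intro: rtrancl_into_rtrancl)
  have BF: "(B, F i) \<in> (d_covers k)\<^sup>*" "(C, F i) \<in> (d_covers k)\<^sup>*" if "3 \<le> i" "i \<le> k" for i
    using d_covers_F_chain[of 3 i k] that s by (auto intro: converse_rtrancl_into_rtrancl)
  have AF: "(A i, F j) \<in> (d_covers k)\<^sup>*" if "3 \<le> i" "i \<le> k" "3 \<le> j" "j \<le> k" for i j
    using AB(1)[of i] BF(1)[of j] that by (auto intro: rtrancl_trans)
  have "(x, y) \<in> (d_covers k)\<^sup>*"
    using a AB BF AF d_covers_A_chain d_covers_F_chain by (cases x; cases y) auto
  then show "(x, y) \<in> d_poset k"
    using a by (auto simp: d_poset_def d_verts_eq rtrancl_eq_or_trancl)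
qed

section \<open>Covers in a locally finite poset\<close>

locale lf_poset =
  fixes P :: "'a rel"
  assumes po: "Partial_order P" and lf: "locally_finite P"
begin

lemma P_refl: "x \<in> Field P \<Longrightarrow> (x, x) \<in> P"
  using po by (auto simp: partial_order_on_def preorder_on_def refl_on_def)

lemma P_trans: "(x, y) \<in> P \<Longrightarrow> (y, z) \<in> P \<Longrightarrow> (x, z) \<in> P"
  using po by (auto simp: partial_order_on_def preorder_on_def dest: transD)

lemma P_antisym: "(x, y) \<in> P \<Longrightarrow> (y, x) \<in> P \<Longrightarrow> x = y"
  using po by (auto simp: partial_order_on_def dest: antisymD)

lemma P_refl1: "(x, y) \<in> P \<Longrightarrow> (x, x) \<in> P" and P_refl2: "(x, y) \<in> P \<Longrightarrow> (y, y) \<in> P"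
  by (auto intro: P_refl FieldI1 FieldI2)

lemma covby_le: "covby P x y \<Longrightarrow> (x, y) \<in> P"
  by (simp add: covby_def)

text \<open>Induction on the size of \<open>interval P v z\<close>, which is finite: if
  \<open>z\<close> does not cover \<open>v\<close>, an element strictly between starts a smaller
  interval. \<open>ex_upper_cover\<close> is the mirror image.\<close>

lemma ex_lower_cover:
  assumes "(v, z) \<in> P" "v \<noteq> z"
  shows "\<exists>x. (v, x) \<in> P \<and> covby P x z"
  using assms
proof (induction "card (interval P v z)" arbitrary: v rule: less_induct)
  case less
  show ?case
  proof (cases "covby P v z")
    case True
    then show ?thesis using less.prems P_refl1 by blast
  next
    case False
    then obtain y where y: "(v, y) \<in> P" "(y, z) \<in> P" "y \<noteq> v" "y \<noteq> z"
      using less.prems by (auto simp: covby_def)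
    have "interval P y z \<subset> interval P v z"
      using y P_trans P_antisym P_refl1[OF y(1)] less.prems unfolding interval_def by blast
    then have "card (interval P y z) < card (interval P v z)"
      using lf by (auto simp: locally_finite_def intro: psubset_card_mono)
    then show ?thesis using less.hyps y P_trans by blast
  qed
qed

lemma ex_upper_cover:
  assumes "(w, v) \<in> P" "w \<noteq> v"
  shows "\<exists>x. covby P w x \<and> (x, v) \<in> P"
  using assms
proof (induction "card (interval P w v)" arbitrary: v rule: less_induct)
  case less
  show ?case
  proof (cases "covby P w v")
    case True
    then show ?thesis using less.prems P_refl2 by blast
  next
    case False
    then obtain y where y: "(w, y) \<in> P" "(y, v) \<in> P" "y \<noteq> v" "y \<noteq> w"
      using less.prems by (auto simp: covby_def)
    have "interval P w y \<subset> interval P w v"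
      using y P_trans P_antisym P_refl2[OF y(2)] less.prems unfolding interval_def by blast
    then have "card (interval P w y) < card (interval P w v)"
      using lf by (auto simp: locally_finite_def intro: psubset_card_mono)
    then show ?thesis using less.hyps y P_trans by blast
  qed
qed

lemma convex_interval: "convex_in P (interval P x y)"
  unfolding convex_in_def interval_def by (auto intro: P_trans FieldI1 FieldI2)

section \<open>Convex copies of d_k(1) and its truncations\<close>

text \<open>Maps go from the vertices into \<open>P\<close>, against the direction of
  \<open>iso\<close> in the definitions; injectivity follows from antisymmetry of
  \<open>d_le\<close>.\<close>

definition d_emb :: "d_elem set \<Rightarrow> (d_elem \<Rightarrow> 'a) \<Rightarrow> bool" where
  "d_emb V h \<longleftrightarrow> (\<forall>x\<in>V. \<forall>y\<in>V. (h x, h y) \<in> P \<longleftrightarrow> d_le x y)"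

text \<open>The chain lengths vary independently: \<open>n = m = k\<close> gives d_k-intervals,
  \<open>n = k\<close> and \<open>m = k - 1\<close> give d_k^- sets. With \<open>m = 2\<close> there
  is no \<open>F\<close> vertex, as in d_3^- sets.\<close>

definition d_config :: "nat \<Rightarrow> nat \<Rightarrow> (d_elem \<Rightarrow> 'a) \<Rightarrow> bool" where
  "d_config n m h \<longleftrightarrow> 3 \<le> n \<and> d_emb (verts n m) h \<and> convex_in P (h ` verts n m)"

lemma d_emb_iff: "d_emb V h \<Longrightarrow> x \<in> V \<Longrightarrow> y \<in> V \<Longrightarrow> (h x, h y) \<in> P \<longleftrightarrow> d_le x y"
  by (simp add: d_emb_def)

lemma d_emb_eq_iff: "d_emb V h \<Longrightarrow> x \<in> V \<Longrightarrow> y \<in> V \<Longrightarrow> h x = h y \<longleftrightarrow> x = y"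
  by (metis d_emb_iff d_le_refl d_le_antisym)

text \<open>The two kinds of maps are inverse to each other. The orders are reflexive, so the fields
  in \<open>iso_iff2\<close> are all of \<open>S\<close> and \<open>V\<close>.\<close>

lemma iso_restr_iff:
  assumes k: "3 \<le> k" and V: "V \<subseteq> verts k k" and S: "S \<subseteq> Field P"
  shows "(\<exists>f. iso (Restr P S) (Restr (d_poset k) V) f) \<longleftrightarrow> (\<exists>h. S = h ` V \<and> d_emb V h)"
proof -
  have FS: "Field (Restr P S) = S"
    using S po by (simp add: Refl_Field_Restr2 partial_order_on_def preorder_on_def)
  have le: "(x, y) \<in> Restr (d_poset k) V \<longleftrightarrow> x \<in> V \<and> y \<in> V \<and> d_le x y" for x y
    using V by (auto simp: d_poset_iff[OF k])
  have FV: "Field (Restr (d_poset k) V) = V"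
    using le d_le_refl unfolding Field_def by blast
  show ?thesis
  proof
    assume "\<exists>f. iso (Restr P S) (Restr (d_poset k) V) f"
    then obtain f where i: "iso (Restr P S) (Restr (d_poset k) V) f" by blast
    then have b: "bij_betw f S V" by (simp add: iso_iff2 FS FV)
    have "(a, b) \<in> P \<longleftrightarrow> d_le (f a) (f b)" if "a \<in> S" "b \<in> S" for a b
    proof -
      have "(a, b) \<in> Restr P S \<longleftrightarrow> (f a, f b) \<in> Restr (d_poset k) V"
        using i that unfolding iso_iff2 FS by blast
      then show ?thesis unfolding le using that bij_betwE[OF b] by blast
    qed
    note f = b this
    let ?h = "inv_into S f"
    have b: "bij_betw ?h V S" using f(1) by (rule bij_betw_inv_into)
    have "f (?h x) = x" if "x \<in> V" for x
      using f(1) that by (rule bij_betw_inv_into_right)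
    then have "d_emb V ?h"
      unfolding d_emb_def using f(2) bij_betwE[OF b] by simp
    moreover have "S = ?h ` V" using b by (simp add: bij_betw_def)
    ultimately show "\<exists>h. S = h ` V \<and> d_emb V h" by blast
  next
    assume "\<exists>h. S = h ` V \<and> d_emb V h"
    then obtain h where h: "S = h ` V" "d_emb V h" by blast
    have b: "bij_betw h V S"
      using h by (auto simp: bij_betw_def inj_on_def d_emb_eq_iff)
    let ?f = "inv_into V h"
    have fb: "bij_betw ?f S V" using b by (rule bij_betw_inv_into)
    have r: "h (?f x) = x" if "x \<in> S" for x
      using b that by (rule bij_betw_inv_into_right)
    have "(a, c) \<in> P \<longleftrightarrow> d_le (?f a) (?f c)" if "a \<in> S" "c \<in> S" for a c
      using d_emb_iff[OF h(2), of "?f a" "?f c"] that bij_betwE[OF fb] r by auto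
    then have "iso (Restr P S) (Restr (d_poset k) V) ?f"
      using fb bij_betwE[OF fb] unfolding iso_iff2 FS FV le by blast
    then show "\<exists>f. iso (Restr P S) (Restr (d_poset k) V) f" by blast
  qed
qed

lemma d_minus_set_iff:
  assumes k: "3 \<le> k"
  shows "d_minus_set k P S \<longleftrightarrow> (\<exists>h. d_config k (k - 1) h \<and> S = h ` verts k (k - 1))"
proof -
  have V: "verts k (k - 1) \<subseteq> verts k k" by (simp add: verts_mono)
  show ?thesis
  proof (cases "S \<subseteq> Field P")
    case True
    show ?thesis
      unfolding d_minus_set_def d_verts_minus_eq[OF k] iso_restr_iff[OF k V True] d_config_def
      using k by blast
  qed (auto simp: d_minus_set_def d_config_def convex_in_def)
qed

text \<open>Convexity gives one inclusion, extremality of \<open>A n\<close> and \<open>F m\<close>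
  the other. The bound \<open>3 \<le> m\<close> provides the maximum; a d_3^- set has two maximal
  elements and is no interval.\<close>

lemma interval_d_config:
  assumes "d_config n m h" "3 \<le> m"
  shows "interval P (h (A n)) (h (F m)) = h ` verts n m"
proof
  have n: "3 \<le> n" and e: "d_emb (verts n m) h" and c: "convex_in P (h ` verts n m)"
    using assms by (auto simp: d_config_def)
  show "interval P (h (A n)) (h (F m)) \<subseteq> h ` verts n m"
    using c n assms(2) unfolding convex_in_def by (meson imageI mem_verts order_refl)
  have "d_le (A n) x \<and> d_le x (F m)" if "x \<in> verts n m" for x
    using that by (cases x) auto
  then show "h ` verts n m \<subseteq> interval P (h (A n)) (h (F m))"
    using n assms(2) d_emb_iff[OF e] by (auto simp: interval_def)
qed

text \<open>With a minimum and a maximum present, being convex and being an interval amount to the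
  same.\<close>

lemma d_interval_iff:
  assumes k: "3 \<le> k"
  shows "d_interval k P S \<longleftrightarrow> (\<exists>h. d_config k k h \<and> S = h ` verts k k)"
proof
  have e: "d_poset k = Restr (d_poset k) (verts k k)"
    using d_poset_iff[OF k] by auto
  have i: "(\<exists>f. iso (Restr P S) (d_poset k) f) \<longleftrightarrow> (\<exists>h. S = h ` verts k k \<and> d_emb (verts k k) h)"
    if "S \<subseteq> Field P"
    using iso_restr_iff[OF k order_refl that] e by simp
  {
    assume "d_interval k P S"
    then have "convex_in P S" "\<exists>f. iso (Restr P S) (d_poset k) f"
      by (auto simp: d_interval_def convex_interval)
    then show "\<exists>h. d_config k k h \<and> S = h ` verts k k"
      using i k by (auto simp: d_config_def convex_in_def)
  }
  assume "\<exists>h. d_config k k h \<and> S = h ` verts k k"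
  then obtain h where h: "d_config k k h" "S = h ` verts k k" by blast
  then have "S \<subseteq> Field P" and "\<exists>f. iso (Restr P S) (d_poset k) f"
    using i by (auto simp: d_config_def convex_in_def)
  moreover have "S = interval P (h (A k)) (h (F k))"
    using interval_d_config[OF h(1) k] h(2) by simp
  moreover have "(h (A k), h (F k)) \<in> P"
    using h(1) k by (auto simp: d_config_def d_emb_def)
  ultimately show "d_interval k P S" unfolding d_interval_def by blast
qed

lemma d_config_le_iff:
  "d_config n m h \<Longrightarrow> x \<in> verts n m \<Longrightarrow> y \<in> verts n m \<Longrightarrow> (h x, h y) \<in> P \<longleftrightarrow> d_le x y"
  by (auto simp: d_config_def d_emb_iff)

lemma d_config_eq_iff:
  "d_config n m h \<Longrightarrow> x \<in> verts n m \<Longrightarrow> y \<in> verts n m \<Longrightarrow> h x = h y \<longleftrightarrow> x = y"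
  unfolding d_config_def using d_emb_eq_iff by blast

lemma d_config_between:
  assumes "d_config n m h" "x \<in> verts n m" "y \<in> verts n m" "(h x, v) \<in> P" "(v, h y) \<in> P"
  shows "\<exists>z\<in>verts n m. v = h z \<and> d_le x z \<and> d_le z y"
proof -
  have "v \<in> h ` verts n m"
    using assms unfolding d_config_def convex_in_def interval_def by blast
  then obtain z where "z \<in> verts n m" "v = h z" by blast
  then show ?thesis using d_config_le_iff assms by blast
qed

text \<open>Lets arguments at smaller parameters use restrictions of one fixed map. Convexity
  survives because \<open>verts n' m'\<close> contains all vertices between two of its
  members.\<close>

lemma d_config_restrict:
  assumes h: "d_config n m h" and n: "3 \<le> n'" "n' \<le> n" "m' \<le> m"
  shows "d_config n' m' h"
proof -
  have V: "verts n' m' \<subseteq> verts n m" using n by (simp add: verts_mono)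
  have "interval P (h x) (h y) \<subseteq> h ` verts n' m'" if "x \<in> verts n' m'" "y \<in> verts n' m'" for x y
  proof
    fix v assume "v \<in> interval P (h x) (h y)"
    then have "\<exists>z\<in>verts n m. v = h z \<and> d_le x z \<and> d_le z y"
      using V that by (intro d_config_between[OF h]) (auto simp: interval_def)
    then obtain z where "z \<in> verts n m" "v = h z" "d_le x z" "d_le z y" by blast
    then show "v \<in> h ` verts n' m'" using verts_convex that n by blast
  qed
  moreover have "h ` verts n' m' \<subseteq> Field P"
    using h V unfolding d_config_def convex_in_def by blast
  ultimately have "convex_in P (h ` verts n' m')"
    unfolding convex_in_def by blast
  moreover have "d_emb (verts n' m') h"
    unfolding d_emb_def using d_config_le_iff[OF h] V by blast
  ultimately show ?thesis using n by (simp add: d_config_def)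
qed

text \<open>Convexity rules out elements of \<open>P\<close> outside the configuration between two
  of its members, so covers can be computed in \<open>d_le\<close>.\<close>

lemma d_config_covby:
  assumes h: "d_config n m h" and xy: "x \<in> verts n m" "y \<in> verts n m"
  shows "covby P (h x) (h y) \<longleftrightarrow>
    d_le x y \<and> x \<noteq> y \<and> (\<forall>z\<in>verts n m. d_le x z \<and> d_le z y \<longrightarrow> z = x \<or> z = y)"
proof
  assume "covby P (h x) (h y)"
  then show "d_le x y \<and> x \<noteq> y \<and> (\<forall>z\<in>verts n m. d_le x z \<and> d_le z y \<longrightarrow> z = x \<or> z = y)"
    unfolding covby_def using d_config_le_iff[OF h] d_config_eq_iff[OF h] xy by metis
next
  assume "d_le x y \<and> x \<noteq> y \<and> (\<forall>z\<in>verts n m. d_le x z \<and> d_le z y \<longrightarrow> z = x \<or> z = y)"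
  then show "covby P (h x) (h y)"
    unfolding covby_def
    using d_config_le_iff[OF h] d_config_eq_iff[OF h] d_config_between[OF h xy] xy by metis
qed

section \<open>Configurations recognised by their covering relations\<close>

text \<open>Records the covers of the diagram alone, without incomparability or convexity; this is
  what can be checked directly for a map assembled by hand.\<close>

definition cover_map :: "nat \<Rightarrow> nat \<Rightarrow> (d_elem \<Rightarrow> 'a) \<Rightarrow> bool" where
  "cover_map n m h \<longleftrightarrow> 3 \<le> n \<and>
     (\<forall>i. 3 \<le> i \<and> i < n \<longrightarrow> covby P (h (A (Suc i))) (h (A i))) \<and>
     covby P (h (A 3)) (h B) \<and> covby P (h (A 3)) (h C) \<and>
     (3 \<le> m \<longrightarrow> covby P (h B) (h (F 3)) \<and> covby P (h C) (h (F 3))) \<and>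
     (\<forall>i. 3 \<le> i \<and> i < m \<longrightarrow> covby P (h (F i)) (h (F (Suc i))))"

lemma cover_map_mono:
  assumes h: "cover_map n m h" and xy: "x \<in> verts n m" "y \<in> verts n m" and le: "d_le x y"
  shows "(h x, h y) \<in> P"
proof -
  have cA: "(h (A (Suc i)), h (A i)) \<in> P" if "3 \<le> i" "i < n" for i
    using h that by (auto simp: cover_map_def covby_def)
  have cF: "(h (F i), h (F (Suc i))) \<in> P" if "3 \<le> i" "i < m" for i
    using h that by (auto simp: cover_map_def covby_def)
  have s: "(h (A 3), h B) \<in> P" "(h (A 3), h C) \<in> P"
    and t: "3 \<le> m \<Longrightarrow> (h B, h (F 3)) \<in> P" "3 \<le> m \<Longrightarrow> (h C, h (F 3)) \<in> P"
    using h by (auto simp: cover_map_def covby_def)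
  have AA: "(h (A i), h (A j)) \<in> P" if "3 \<le> j" "j \<le> i" "i \<le> n" for i j
    using that(2,3)
  proof (induction i rule: dec_induct)
    \<comment> \<open>Reflexivity is available only on the field of \<open>P\<close>; a neighbouring
      cover shows that \<open>h (A j)\<close> lies in it.\<close>
    case base
    show ?case
    proof (cases "j = 3")
      case True
      then show ?thesis using s P_refl1 by blast
    next
      case False
      then have "(h (A j), h (A (j - 1))) \<in> P" using cA[of "j - 1"] that by simp
      then show ?thesis by (rule P_refl1)
    qed
  next
    case (step i)
    then have "(h (A (Suc i)), h (A i)) \<in> P" "(h (A i), h (A j)) \<in> P" using cA[of i] that by auto
    then show ?case by (rule P_trans)
  qed
  have FF: "(h (F i), h (F j)) \<in> P" if "3 \<le> i" "i \<le> j" "j \<le> m" for i j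
    using that(2,3)
  proof (induction j rule: dec_induct)
    case base
    show ?case
    proof (cases "i = 3")
      case True
      then show ?thesis using t that P_refl2 by fastforce
    next
      case False
      then have "(h (F (i - 1)), h (F i)) \<in> P" using cF[of "i - 1"] that by simp
      then show ?thesis by (rule P_refl2)
    qed
  next
    case (step j)
    then have "(h (F i), h (F j)) \<in> P" "(h (F j), h (F (Suc j))) \<in> P" using cF[of j] that by auto
    then show ?case by (rule P_trans)
  qed
  have AB: "(h (A i), h B) \<in> P" "(h (A i), h C) \<in> P" if "3 \<le> i" "i \<le> n" for i
    using AA[of 3 i] that s P_trans by auto
  have BF: "(h B, h (F i)) \<in> P" "(h C, h (F i)) \<in> P" if "3 \<le> i" "i \<le> m" for i
    using FF[of 3 i] that t P_trans by fastforce+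
  have AF: "(h (A i), h (F j)) \<in> P" if "3 \<le> i" "i \<le> n" "3 \<le> j" "j \<le> m" for i j
    using AB(1)[of i] BF(1)[of j] that P_trans by blast
  have BC: "(h B, h B) \<in> P" "(h C, h C) \<in> P" using s P_refl2 by blast+
  show ?thesis
    using xy le by (cases x; cases y) (simp_all add: AA AB BF AF FF BC)
qed

text \<open>Supplies the first cover on a path from \<open>x\<close> towards \<open>y\<close>; at
  \<open>A 3\<close> the path turns to \<open>B\<close> or \<open>C\<close> according to
  \<open>y\<close>.\<close>

lemma cover_map_next:
  assumes h: "cover_map n m h" and xy: "x \<in> verts n m" "y \<in> verts n m" and le: "d_le x y" "x \<noteq> y"
  shows "\<exists>x'\<in>verts n m. d_le x' y \<and> covby P (h x) (h x')"
proof (cases x)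
  case (A i)
  show ?thesis
  proof (cases "i = 3")
    case True
    have "covby P (h x) (h B)" "covby P (h x) (h C)"
      using A True h by (auto simp: cover_map_def)
    moreover have "d_le B y \<or> d_le C y" using A True le xy by (cases y) auto
    ultimately show ?thesis using mem_verts(2,3) by blast
  next
    case False
    then obtain j where j: "i = Suc j" "3 \<le> j" using A xy by (cases i) auto
    then have "d_le (A j) y" using A le by (cases y) auto
    then show ?thesis using A xy h j by (auto simp: cover_map_def intro!: bexI[of _ "A j"])
  qed
next
  case B
  then obtain j where "y = F j" using le by (cases y) auto
  then show ?thesis using B xy h by (auto simp: cover_map_def intro!: bexI[of _ "F 3"])
next
  case C
  then obtain j where "y = F j" using le by (cases y) auto
  then show ?thesis using C xy h by (auto simp: cover_map_def intro!: bexI[of _ "F 3"])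
next
  case (F i)
  then obtain j where "y = F j" "i < j" using le by (cases y) auto
  then show ?thesis using F xy h by (auto simp: cover_map_def intro!: bexI[of _ "F (Suc i)"])
qed

text \<open>If \<open>x\<close> is strictly below \<open>y\<close> but \<open>h y\<close> is below
  \<open>h x\<close>, the next vertex \<open>x'\<close> towards \<open>y\<close> has
  \<open>h x'\<close> below \<open>h x\<close> although it covers \<open>h x\<close>. Further,
  \<open>h B\<close> and \<open>h C\<close> are incomparable as distinct covers of
  \<open>h (A 3)\<close>.\<close>

lemma cover_map_emb:
  assumes h: "cover_map n m h" and bc: "h B \<noteq> h C"
  shows "d_emb (verts n m) h"
proof -
  have strict: "(h y, h x) \<notin> P" if xy: "x \<in> verts n m" "y \<in> verts n m" "d_le x y" "x \<noteq> y" for x y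
  proof
    assume yx: "(h y, h x) \<in> P"
    obtain x' where x': "x' \<in> verts n m" "d_le x' y" "covby P (h x) (h x')"
      using cover_map_next[OF h xy] by blast
    then have "(h x', h x) \<in> P" using cover_map_mono[OF h] xy yx P_trans by blast
    then show False using x'(3) P_antisym by (auto simp: covby_def)
  qed
  have "(h B, h C) \<notin> P" "(h C, h B) \<notin> P"
    using h bc P_antisym unfolding cover_map_def covby_def by metis+
  then show ?thesis
    unfolding d_emb_def using strict cover_map_mono[OF h] d_le_linear by (metis d_le.simps(7,10))
qed

lemma d_config_cover_map:
  assumes h: "d_config n m h"
  shows "cover_map n m h"
proof -
  have n: "3 \<le> n" using h by (simp add: d_config_def)
  \<comment> \<open>The index exceeds \<open>n\<close> and \<open>m\<close>, so
    \<open>d_covers\<close> contains every covering pair of \<open>verts n m\<close>.\<close>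
  have *: "covby P (h x) (h y)"
    if "x \<in> verts n m" "y \<in> verts n m" "(x, y) \<in> d_covers (Suc (max n m))" for x y
  proof -
    have "z = x \<or> z = y" if "z \<in> verts n m" "d_le x z" "d_le z y" for z
      using that \<open>(x, y) \<in> d_covers (Suc (max n m))\<close> by (cases z) (auto simp: d_covers_def)
    moreover have "d_le x y" "x \<noteq> y"
      using that(3) by (auto simp: d_covers_def)
    ultimately show ?thesis using d_config_covby[OF h that(1,2)] by blast
  qed
  show ?thesis
    unfolding cover_map_def by (intro conjI allI impI *) (use n in \<open>auto simp: d_covers_def\<close>)
qed

text \<open>Intervals are convex, so it remains to bound the interval from above; the other
  inclusion holds for any embedding.\<close>

lemma d_config_intro_interval:
  assumes h: "cover_map n m h" and bc: "h B \<noteq> h C" and m: "3 \<le> m"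
    and sub: "interval P (h (A n)) (h (F m)) \<subseteq> h ` verts n m"
  shows "d_config n m h"
proof -
  have e: "d_emb (verts n m) h" using cover_map_emb[OF h bc] .
  have n: "3 \<le> n" using h by (simp add: cover_map_def)
  have "d_le (A n) x \<and> d_le x (F m)" if "x \<in> verts n m" for x
    using that by (cases x) auto
  then have "h ` verts n m \<subseteq> interval P (h (A n)) (h (F m))"
    using n m d_emb_iff[OF e] by (auto simp: interval_def)
  with sub have "h ` verts n m = interval P (h (A n)) (h (F m))" by blast
  then show ?thesis using n e convex_interval by (simp add: d_config_def)
qed

lemma verts_3_2: "verts 3 2 = {A 3, B, C}"
  by (auto simp: verts_def)

text \<open>In \<open>verts 3 2\<close> every comparable pair is equal or a cover, so convexity
  comes for free.\<close>

lemma d_config_3_2_iff: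
  "d_config 3 2 h \<longleftrightarrow> covby P (h (A 3)) (h B) \<and> covby P (h (A 3)) (h C) \<and> h B \<noteq> h C"
proof
  assume "d_config 3 2 h"
  then show "covby P (h (A 3)) (h B) \<and> covby P (h (A 3)) (h C) \<and> h B \<noteq> h C"
    using d_config_cover_map[of 3 2 h] d_config_eq_iff[of 3 2 h B C] by (simp add: cover_map_def)
next
  assume a: "covby P (h (A 3)) (h B) \<and> covby P (h (A 3)) (h C) \<and> h B \<noteq> h C"
  then have c: "cover_map 3 2 h" by (auto simp: cover_map_def)
  then have e: "d_emb (verts 3 2) h" using a cover_map_emb by blast
  have "v \<in> h ` verts 3 2"
    if "x \<in> verts 3 2" "y \<in> verts 3 2" "(h x, v) \<in> P" "(v, h y) \<in> P" for x y v
  proof -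
    have "d_le x y" using d_emb_iff[OF e] that P_trans by blast
    then have "v = h x \<or> v = h y"
      using that a P_antisym by (auto simp: verts_3_2 covby_def)
    then show ?thesis using that by blast
  qed
  moreover have "h ` verts 3 2 \<subseteq> Field P"
    using d_emb_iff[OF e] d_le_refl FieldI1 by fast
  ultimately have "convex_in P (h ` verts 3 2)"
    by (auto simp: convex_in_def interval_def)
  then show "d_config 3 2 h" using e by (simp add: d_config_def)
qed

section \<open>Maxima and completing elements\<close>

lemma d_config_maximum_iff:
  assumes h: "d_config k k h"
  shows "maximum_of P (h ` verts k k) m \<longleftrightarrow> m = h (F k)"
proof -
  have "3 \<le> k" using h by (simp add: d_config_def)
  moreover have "d_le x (F k)" if "x \<in> verts k k" for x
    using that by (cases x) auto
  ultimately have "maximum_of P (h ` verts k k) (h (F k))"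
    using d_config_le_iff[OF h] by (auto simp: maximum_of_def)
  then show ?thesis using P_antisym unfolding maximum_of_def by blast
qed

lemma finite_verts: "finite (verts n m)"
  by (simp add: verts_def)

text \<open>Counting: d_k(1) has one vertex more than d_k(1) without its top, so the added element
  must be new.\<close>

lemma d_interval_insert_notin:
  assumes h: "d_config k (k - 1) h" and z: "d_interval k P (h ` verts k (k - 1) \<union> {z})"
  shows "z \<notin> h ` verts k (k - 1)"
proof
  assume "z \<in> h ` verts k (k - 1)"
  have k: "3 \<le> k" using h by (simp add: d_config_def)
  from z obtain g where g: "d_config k k g" "h ` verts k (k - 1) \<union> {z} = g ` verts k k"
    using d_interval_iff[OF k] by blast
  have "inj_on h (verts k (k - 1))" "inj_on g (verts k k)"
    using d_config_eq_iff[OF h] d_config_eq_iff[OF g(1)] by (auto simp: inj_on_def)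
  moreover have "h ` verts k (k - 1) = g ` verts k k" using g(2) \<open>z \<in> _\<close> by blast
  ultimately have "card (verts k (k - 1)) = card (verts k k)" by (metis card_image)
  moreover have "F k \<notin> verts k (k - 1)" using k by simp
  ultimately show False using verts_insert_top[OF k] by (simp add: finite_verts)
qed

lemma image_upd_top:
  "3 \<le> k \<Longrightarrow> (h(F k := z)) ` verts k k = h ` verts k (k - 1) \<union> {z}"
  by (auto simp: verts_insert_top)

text \<open>The parametrisation of the completed set can be chosen to extend the given
  \<open>h\<close>: \<open>z\<close> is new and the maximum, hence strictly above the image of
  \<open>h\<close>, and the interval property gives convexity.\<close>

lemma completing_iff:
  assumes h: "d_config k (k - 1) h"
  shows "completing k P (h ` verts k (k - 1)) z \<longleftrightarrow> d_config k k (h(F k := z))"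
proof
  have k: "3 \<le> k" using h by (simp add: d_config_def)
  {
    assume "completing k P (h ` verts k (k - 1)) z"
    then have i: "d_interval k P (h ` verts k (k - 1) \<union> {z})"
      and m: "maximum_of P (h ` verts k (k - 1) \<union> {z}) z"
      by (auto simp: completing_def)
    have z: "z \<notin> h ` verts k (k - 1)" using d_interval_insert_notin[OF h i] .
    have "(h x, z) \<in> P" "(z, h x) \<notin> P" if "x \<in> verts k (k - 1)" for x
      using m z that P_antisym unfolding maximum_of_def by blast+
    moreover have "(z, z) \<in> P" using m by (auto simp: maximum_of_def)
    moreover have "d_le x (F k) \<and> \<not> d_le (F k) x" if "x \<in> verts k (k - 1)" for x
      using that k by (cases x) auto
    moreover have "x \<noteq> F k" if "x \<in> verts k (k - 1)" for x
      using that k by auto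
    ultimately have "d_emb (verts k k) (h(F k := z))"
      using d_config_le_iff[OF h] by (simp add: d_emb_def verts_insert_top[OF k])
    moreover have "convex_in P (h ` verts k (k - 1) \<union> {z})"
      using i convex_interval by (auto simp: d_interval_def)
    ultimately show "d_config k k (h(F k := z))"
      unfolding d_config_def using k by (simp only: image_upd_top simp_thms)
  }
  assume g: "d_config k k (h(F k := z))"
  then have "d_interval k P ((h(F k := z)) ` verts k k)"
    using d_interval_iff[OF k] by blast
  moreover have "maximum_of P ((h(F k := z)) ` verts k k) z"
    using d_config_maximum_iff[OF g] by simp
  ultimately show "completing k P (h ` verts k (k - 1)) z"
    unfolding completing_def by (simp only: image_upd_top[OF k])
qed

lemma completing_config:
  assumes h: "d_config k k h"
  shows "completing k P (h ` verts k (k - 1)) (h (F k))"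
proof -
  have "3 \<le> k" using h by (simp add: d_config_def)
  then have "d_config k (k - 1) h" using d_config_restrict[OF h] by simp
  then show ?thesis using h completing_iff by (metis fun_upd_triv)
qed

text \<open>Needed because \<open>DmC\<close> does not say that the added element is the maximum. If
  it is not, convexity of the image of \<open>h\<close> forces it to be the minimum, which leaves
  too few vertices below the incomparable pair.\<close>

lemma d_interval_insert_completing:
  assumes h: "d_config k (k - 1) h" and z: "d_interval k P (h ` verts k (k - 1) \<union> {z})"
  shows "completing k P (h ` verts k (k - 1)) z"
proof -
  let ?S = "h ` verts k (k - 1)"
  have k: "3 \<le> k" using h by (simp add: d_config_def)
  have zS: "z \<notin> ?S" using d_interval_insert_notin[OF h z] .
  obtain g where g: "d_config k k g" "?S \<union> {z} = g ` verts k k"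
    using z d_interval_iff[OF k] by blast
  have "z = g (F k)"
  proof (rule ccontr)
    assume zF: "z \<noteq> g (F k)"
    have FS: "g (F k) \<in> ?S" using g(2) zF k by auto
    obtain v where v: "v \<in> verts k k" "z = g v" using g(2) by blast
    \<comment> \<open>Otherwise \<open>z\<close> lies between the bottom and the top of the large
      set, both of which belong to the convex set \<open>?S\<close>.\<close>
    have zA: "z = g (A k)"
    proof (rule ccontr)
      assume "z \<noteq> g (A k)"
      then have "g (A k) \<in> ?S" using g(2) k by auto
      moreover have "d_le (A k) v" "d_le v (F k)" using v(1) by (cases v; auto)+
      then have "z \<in> interval P (g (A k)) (g (F k))"
        using v k d_config_le_iff[OF g(1)] by (auto simp: interval_def)
      ultimately show False
        using FS zS h unfolding d_config_def convex_in_def by blast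
    qed
    have pre: "\<exists>y\<in>verts k k. h x = g y \<and> y \<noteq> A k" if "x \<in> verts k (k - 1)" for x
    proof -
      have "h x \<in> g ` verts k k" "h x \<noteq> z" using g(2) that zS by blast+
      then show ?thesis using zA by auto
    qed
    obtain p where p: "p \<in> verts k k" "h B = g p" using pre[of B] by auto
    obtain q where q: "q \<in> verts k k" "h C = g q" using pre[of C] by auto
    have pq: "\<not> d_le p q" "\<not> d_le q p"
      using d_config_le_iff[OF h, of B C] d_config_le_iff[OF h, of C B]
        d_config_le_iff[OF g(1)] p q by auto
    \<comment> \<open>Each \<open>h (A i)\<close> lies below the incomparable \<open>h B\<close> and
      \<open>h C\<close>, hence is an \<open>A\<close> vertex of \<open>g\<close> other than its
      bottom. So \<open>k - 2\<close> elements would have to fit into \<open>k - 3\<close>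
      places.\<close>
    have "h (A i) \<in> (g \<circ> A) ` {3..k - 1}" if i: "i \<in> {3..k}" for i
    proof -
      obtain y where y: "y \<in> verts k k" "h (A i) = g y" "y \<noteq> A k" using pre[of "A i"] i by auto
      have "d_le y p" "d_le y q"
        using d_config_le_iff[OF h, of "A i" B] d_config_le_iff[OF h, of "A i" C]
          d_config_le_iff[OF g(1)] p q y i by auto
      then obtain j where "y = A j" using pq by (cases y; cases p; cases q) auto
      then show ?thesis using y by auto
    qed
    then have "(h \<circ> A) ` {3..k} \<subseteq> (g \<circ> A) ` {3..k - 1}" by auto
    then have "card ((h \<circ> A) ` {3..k}) \<le> card {3..k - 1}"
      by (meson card_image_le card_mono finite_atLeastAtMost finite_imageI le_trans)
    moreover have "inj_on (h \<circ> A) {3..k}"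
      using d_config_eq_iff[OF h] by (auto simp: inj_on_def)
    then have "card ((h \<circ> A) ` {3..k}) = card {3..k}" by (rule card_image)
    ultimately show False using k by simp
  qed
  then show ?thesis
    unfolding completing_def using z g d_config_maximum_iff[OF g(1)] by simp
qed

section \<open>Overlap as a change of the bottom element\<close>

lemma interval_eqD:
  assumes eq: "interval P x y = interval P x' y'" and xy: "(x, y) \<in> P"
  shows "x = x' \<and> y = y'"
proof -
  have "x \<in> interval P x y" "y \<in> interval P x y"
    using xy P_refl1[OF xy] P_refl2[OF xy] by (auto simp: interval_def)
  then have *: "(x', x) \<in> P" "(y, y') \<in> P" unfolding eq by (auto simp: interval_def)
  then have "(x', y') \<in> P" using xy P_trans by blast
  then have "x' \<in> interval P x' y'" "y' \<in> interval P x' y'"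
    using P_refl1 P_refl2 by (auto simp: interval_def)
  then have "(x, x') \<in> P" "(y', y) \<in> P" unfolding eq[symmetric] by (auto simp: interval_def)
  then show ?thesis using * P_antisym by blast
qed

lemma image_upd_bot:
  assumes "3 \<le> k" shows "(h(A k := w)) ` verts k m = insert w (h ` (verts k m - {A k}))"
proof -
  have "verts k m = insert (A k) (verts k m - {A k})" using assms by (simp add: insert_absorb)
  moreover have "(h(A k := w)) ` (verts k m - {A k}) = h ` (verts k m - {A k})"
    by (intro image_cong) auto
  ultimately show ?thesis by (metis fun_upd_same image_insert)
qed

lemma NODm_3_iff:
  "NODm 3 P \<longleftrightarrow> \<not> (\<exists>h w. d_config 3 2 h \<and> d_config 3 2 (h(A 3 := w)) \<and> w \<noteq> h (A 3))"
proof -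
  have "\<exists>h w. d_config 3 2 h \<and> d_config 3 2 (h(A 3 := w)) \<and> w \<noteq> h (A 3)"
    if "overlapping 3 P S T" for S T
  proof -
    have "\<exists>w w' x y. w \<noteq> w' \<and> x \<noteq> y \<and> S = {w, x, y} \<and> T = {w', x, y} \<and>
      covby P w x \<and> covby P w y \<and> covby P w' x \<and> covby P w' y"
      using that by (simp add: overlapping_def)
    then obtain w w' x y where "w \<noteq> w'" "x \<noteq> y" "covby P w x" "covby P w y" "covby P w' x" "covby P w' y"
      by blast
    then show ?thesis
      by (intro exI[of _ "(\<lambda>_. w)(B := x, C := y)"] exI[of _ w']) (simp add: d_config_3_2_iff)
  qed
  moreover have "overlapping 3 P (h ` verts 3 2) ((h(A 3 := w)) ` verts 3 2)"
    if "d_config 3 2 h" "d_config 3 2 (h(A 3 := w))" "w \<noteq> h (A 3)" for h w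
  proof -
    have "d_minus_set 3 P (h ` verts 3 2)" "d_minus_set 3 P ((h(A 3 := w)) ` verts 3 2)"
      using that d_minus_set_iff[of 3] by (simp_all del: fun_upd_apply) blast+
    moreover have "h ` verts 3 2 = {h (A 3), h B, h C}" "(h(A 3 := w)) ` verts 3 2 = {w, h B, h C}"
      by (auto simp: verts_3_2)
    moreover have "w \<noteq> h (A 3)" "h B \<noteq> h C" "covby P (h (A 3)) (h B)" "covby P (h (A 3)) (h C)"
      "covby P w (h B)" "covby P w (h C)"
      using that by (auto simp: d_config_3_2_iff)
    ultimately show ?thesis unfolding overlapping_def if_P[OF refl] by metis
  qed
  ultimately show ?thesis unfolding NODm_def by blast
qed

text \<open>Overlapping sets agree above their bottoms, so a parametrisation \<open>h\<close> of the
  first, changed at \<open>A k\<close> only, parametrises the second.\<close>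

lemma NODm_iff:
  assumes k: "3 \<le> k"
  shows "NODm k P \<longleftrightarrow>
    \<not> (\<exists>h w. d_config k (k - 1) h \<and> d_config k (k - 1) (h(A k := w)) \<and> w \<noteq> h (A k))"
proof (cases "k = 3")
  case True
  then show ?thesis using NODm_3_iff by simp
next
  case False
  then have k4: "3 \<le> k - 1" using k by simp
  have cov: "covby P (h (A k)) (h (A (k - 1)))"
    "\<And>v. v \<in> h ` verts k (k - 1) \<Longrightarrow> covby P (h (A k)) v \<Longrightarrow> v = h (A (k - 1))"
    if h: "d_config k (k - 1) h" for h
  proof -
    have S: "Suc (k - 1) = k" using k by simp
    show c: "covby P (h (A k)) (h (A (k - 1)))"
      using d_config_cover_map[OF h] k4 k S unfolding cover_map_def
      by (metis diff_less less_le_trans zero_less_numeral zero_less_one)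
    fix v assume v: "v \<in> h ` verts k (k - 1)" "covby P (h (A k)) v"
    then obtain x where x: "x \<in> verts k (k - 1)" "v = h x" by blast
    have "x \<noteq> A k" using v x by (auto simp: covby_def)
    then have "d_le (A (k - 1)) x" using x k by (cases x) auto
    then have "(h (A (k - 1)), v) \<in> P" using d_config_le_iff[OF h] x k4 by simp
    then show "v = h (A (k - 1))" using v c unfolding covby_def by metis
  qed
  have "\<exists>h w. d_config k (k - 1) h \<and> d_config k (k - 1) (h(A k := w)) \<and> w \<noteq> h (A k)"
    if o: "overlapping k P S T" for S T
  proof -
    obtain w w' u z where *: "S = interval P w z" "T = interval P w' z" "w \<noteq> w'"
      "u \<in> interval P w z" "covby P w u" "covby P w' u"
      using o False unfolding overlapping_def by auto
    obtain h g where h: "d_config k (k - 1) h" "S = h ` verts k (k - 1)"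
      and g: "d_config k (k - 1) g" "T = g ` verts k (k - 1)"
      using o d_minus_set_iff[OF k] by (auto simp: overlapping_def)
    have wz: "(w, z) \<in> P" "(u, z) \<in> P" using *(4) P_trans by (auto simp: interval_def)
    have w'z: "(w', z) \<in> P" using wz *(6) P_trans covby_le by blast
    have hw: "w = h (A k)" "z = h (F (k - 1))"
      using interval_eqD[of w z] interval_d_config[OF h(1) k4] * h(2) wz by auto
    have gw: "w' = g (A k)" "z = g (F (k - 1))"
      using interval_eqD[of w' z] interval_d_config[OF g(1) k4] * g(2) w'z by auto
    have uS: "u \<in> S" and uT: "u \<in> T"
      using * wz covby_le by (auto simp: interval_def)
    \<comment> \<open>The bottom of either set has only one cover inside the set, so
      \<open>u\<close> is the vertex \<open>A (k - 1)\<close> in both parametrisations.\<close>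
    have u: "u = h (A (k - 1))" "u = g (A (k - 1))"
      using cov(2)[OF h(1)] cov(2)[OF g(1)] uS uT h g hw gw * by auto
    have "covby P ((h(A k := w')) (A (Suc i))) ((h(A k := w')) (A i))" if "3 \<le> i \<and> i < k" for i
    proof (cases "Suc i = k")
      case True
      then have "i = k - 1" by simp
      then show ?thesis using *(6) u True by auto
    next
      case False
      then show ?thesis using d_config_cover_map[OF h(1)] that by (simp add: cover_map_def)
    qed
    then have "cover_map k (k - 1) (h(A k := w'))"
      using d_config_cover_map[OF h(1)] False by (simp add: cover_map_def)
    \<comment> \<open>Apart from \<open>w'\<close>, every element of \<open>interval P w' z\<close>
      lies above \<open>u\<close> and hence in \<open>interval P w z\<close>, whose elements other
      than \<open>w\<close> are kept.\<close>
    moreover have "v \<in> (h(A k := w')) ` verts k (k - 1)" if v: "v \<in> interval P w' z" for v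
    proof (cases "v = w'")
      case True
      then show ?thesis using k by (simp add: image_upd_bot)
    next
      case False
      obtain y where y: "y \<in> verts k (k - 1)" "v = g y" using v * g by blast
      have "y \<noteq> A k" using False y gw by auto
      then have "d_le (A (k - 1)) y" using y k by (cases y) auto
      then have "(g (A (k - 1)), g y) \<in> P" using d_config_le_iff[OF g(1)] y k4 by simp
      then have uv: "(u, v) \<in> P" using u(2) y(2) by simp
      have wu: "(w, u) \<in> P" "w \<noteq> u" using *(5) by (auto simp: covby_def)
      have "v \<in> S" using P_trans[OF wu(1) uv] v *(1) by (simp add: interval_def)
      moreover have "v \<noteq> w" using P_antisym[OF wu(1)] uv wu(2) by blast
      ultimately show ?thesis using h hw k by (auto simp: image_upd_bot)
    qed
    ultimately have "d_config k (k - 1) (h(A k := w'))"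
      using hw k4 d_config_eq_iff[OF h(1), of B C] by (intro d_config_intro_interval) auto
    then show ?thesis using h * hw by blast
  qed
  moreover have "overlapping k P (h ` verts k (k - 1)) ((h(A k := w)) ` verts k (k - 1))"
    if h: "d_config k (k - 1) h" "d_config k (k - 1) (h(A k := w))" "w \<noteq> h (A k)" for h w
  proof -
    let ?g = "h(A k := w)"
    let ?I = "interval P (h (A k)) (h (F (k - 1)))"
    have S: "h ` verts k (k - 1) = ?I"
      using interval_d_config[OF h(1) k4] by simp
    have T: "?g ` verts k (k - 1) = interval P w (h (F (k - 1)))"
      using interval_d_config[OF h(2) k4] k4 by simp
    have c: "covby P (h (A k)) (h (A (k - 1)))" "covby P w (h (A (k - 1)))"
      using cov(1)[OF h(1)] cov(1)[OF h(2)] k4 by (auto split: if_splits)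
    have u: "h (A (k - 1)) \<in> ?I" unfolding S[symmetric] using k4 by simp
    have v: "\<forall>v\<in>?I. covby P (h (A k)) v \<longrightarrow> v = h (A (k - 1))"
      using cov(2)[OF h(1)] unfolding S by blast
    have "\<exists>w1 w2 u z. h ` verts k (k - 1) = interval P w1 z \<and>
        ?g ` verts k (k - 1) = interval P w2 z \<and> w1 \<noteq> w2 \<and> u \<in> interval P w1 z \<and> covby P w1 u \<and>
        (\<forall>v\<in>interval P w1 z. covby P w1 v \<longrightarrow> v = u) \<and> covby P w2 u"
      by (rule exI[of _ "h (A k)"], rule exI[of _ w], rule exI[of _ "h (A (k - 1))"],
        rule exI[of _ "h (F (k - 1))"]) (intro conjI S T c u v h(3)[symmetric])
    moreover have "d_minus_set k P (h ` verts k (k - 1))" "d_minus_set k P (?g ` verts k (k - 1))"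
      using d_minus_set_iff[OF k] h by blast+
    ultimately show ?thesis
      unfolding overlapping_def using False by (simp del: fun_upd_apply)
  qed
  ultimately show ?thesis unfolding NODm_def by blast
qed

section \<open>Exchanging the bottom below a completing element: (a) and (c)\<close>

text \<open>Follow \<open>v\<close> up to an element covered by the top, which lies in the image by
  \<open>only\<close>. It is not the bottom, because \<open>h B\<close> lies strictly between bottom
  and top; so the bound survives an exchange of the bottom.\<close>

lemma below_top:
  assumes h: "d_config k k h"
    and only: "\<And>x. covby P x (h (F k)) \<Longrightarrow> x \<in> h ` verts k (k - 1)"
    and v: "(v, h (F k)) \<in> P" "v \<noteq> h (F k)"
  shows "\<exists>x\<in>verts k (k - 1). x \<noteq> A k \<and> (v, h x) \<in> P"
proof -
  have k: "3 \<le> k" using h by (simp add: d_config_def)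
  obtain y where y: "(v, y) \<in> P" "covby P y (h (F k))" using ex_lower_cover v by blast
  then obtain x where x: "x \<in> verts k (k - 1)" "y = h x" using only by blast
  have "x \<noteq> A k"
  proof
    assume "x = A k"
    then have "covby P (h (A k)) (h (F k))" using x y by simp
    then have "\<forall>z\<in>verts k k. d_le (A k) z \<and> d_le z (F k) \<longrightarrow> z = A k \<or> z = F k"
      using d_config_covby[OF h, of "A k" "F k"] k by simp
    then show False by (auto dest: bspec[of _ _ B])
  qed
  then show ?thesis using x y by blast
qed

text \<open>The exchange keeps the maximum \<open>h (F k)\<close> but, for
  \<open>w \<noteq> h (A k)\<close>, removes \<open>h (A k)\<close> from the set.\<close>

lemma DMD_config:
  assumes "DMD k P" "d_config k k h" "d_config k k (h(A k := w))"
  shows "w = h (A k)"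
proof (rule ccontr)
  assume w: "w \<noteq> h (A k)"
  let ?g = "h(A k := w)"
  have k: "3 \<le> k" using assms(2) by (simp add: d_config_def)
  have "h (A k) \<notin> ?g ` verts k k"
    using w d_config_eq_iff[OF assms(2)] k by auto
  moreover have "h (A k) \<in> h ` verts k k" using k by simp
  ultimately have "h ` verts k k \<noteq> ?g ` verts k k" by blast
  moreover have "d_interval k P (h ` verts k k)" "d_interval k P (?g ` verts k k)"
    using d_interval_iff[OF k] assms(2,3) by blast+
  moreover have "maximum_of P (h ` verts k k) (h (F k))" "maximum_of P (?g ` verts k k) (h (F k))"
    using d_config_maximum_iff[OF assms(2)] d_config_maximum_iff[OF assms(3)]
    by (simp_all del: fun_upd_apply) simp
  ultimately show False using assms(1) unfolding DMD_def by blast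
qed

lemma DmCF_config:
  assumes "DmCF k P" "d_config k (k - 1) h"
  shows "\<exists>z. d_config k k (h(F k := z)) \<and> (\<forall>x. covby P x z \<longrightarrow> x \<in> h ` verts k (k - 1))"
proof -
  have k: "3 \<le> k" using assms(2) by (simp add: d_config_def)
  let ?S = "h ` verts k (k - 1)"
  have "d_minus_set k P ?S" using d_minus_set_iff[OF k] assms(2) by blast
  then obtain z where z: "d_interval k P (?S \<union> {z})" "maximum_of P (?S \<union> {z}) z"
    "\<forall>x. covby P x z \<longrightarrow> x \<in> ?S \<union> {z}"
    using assms(1) unfolding DmCF_def by blast
  then have "\<forall>x. covby P x z \<longrightarrow> x \<in> ?S" by (auto simp: covby_def)
  moreover have "d_config k k (h(F k := z))"
    using completing_iff[OF assms(2)] z unfolding completing_def by blast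
  ultimately show ?thesis by blast
qed

text \<open>The common end of (a) and (c): the covers at the top come from the first set, those at
  the bottom from the second, so only the elements strictly between \<open>w\<close> and
  \<open>z\<close> remain to be located.\<close>

lemma d_config_swap_bottom:
  assumes g: "d_config k (k - 1) (h(A k := w))" and z: "d_config k k (h(F k := z))"
    and sub: "\<And>v. (w, v) \<in> P \<Longrightarrow> (v, z) \<in> P \<Longrightarrow> v \<noteq> w \<Longrightarrow> v \<noteq> z \<Longrightarrow>
      v \<in> (h(A k := w)) ` verts k (k - 1)"
  shows "d_config k k (h(F k := z, A k := w))"
proof -
  let ?g = "h(F k := z, A k := w)"
  have k: "3 \<le> k" using z by (simp add: d_config_def)
  have img: "?g ` verts k k = (h(A k := w)) ` verts k (k - 1) \<union> {z}"
    using image_upd_top[OF k, of "h(A k := w)" z] fun_upd_twist[of "A k" "F k" h w z] by simp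
  have "covby P (?g (A (Suc i))) (?g (A i))" if "3 \<le> i \<and> i < k" for i
    using d_config_cover_map[OF g] that unfolding cover_map_def by auto
  moreover have "covby P (?g (A 3)) (h B)" "covby P (?g (A 3)) (h C)"
    using d_config_cover_map[OF g] unfolding cover_map_def by auto
  ultimately have "cover_map k k ?g"
    using d_config_cover_map[OF z] unfolding cover_map_def by simp
  moreover have "v \<in> ?g ` verts k k" if "v \<in> interval P w z" for v
  proof -
    have "w \<in> (h(A k := w)) ` verts k (k - 1)" using k by (intro image_eqI[of _ _ "A k"]) auto
    then show ?thesis using sub that unfolding img interval_def by blast
  qed
  moreover have "h B \<noteq> h C" using d_config_eq_iff[OF z, of B C] by simp
  ultimately show ?thesis using k by (intro d_config_intro_interval) auto
qed

lemma NODm_if_DmCF_DMD: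
  assumes k: "3 \<le> k" and "DmCF k P" and D: "DMD k P"
  shows "NODm k P"
  unfolding NODm_iff[OF k]
proof
  assume "\<exists>h w. d_config k (k - 1) h \<and> d_config k (k - 1) (h(A k := w)) \<and> w \<noteq> h (A k)"
  then obtain h w where h: "d_config k (k - 1) h" and g: "d_config k (k - 1) (h(A k := w))"
    and w: "w \<noteq> h (A k)" by blast
  obtain z where z: "d_config k k (h(F k := z))"
    "\<And>x. covby P x z \<Longrightarrow> x \<in> h ` verts k (k - 1)"
    using DmCF_config assms(2) h by blast
  let ?h = "h(F k := z)" and ?g = "h(A k := w)"
  have img: "?h ` verts k (k - 1) = h ` verts k (k - 1)" using k by (intro image_cong) auto
  \<comment> \<open>Such a \<open>v\<close> lies below a member \<open>?h x\<close> other than the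
    bottom. This member is shared with the second set, so convexity of that set captures
    \<open>v\<close>.\<close>
  have "v \<in> ?g ` verts k (k - 1)" if v: "(w, v) \<in> P" "(v, z) \<in> P" "v \<noteq> z" for v
  proof -
    obtain x where x: "x \<in> verts k (k - 1)" "x \<noteq> A k" "(v, ?h x) \<in> P"
      using below_top[OF z(1), of v] z(2) v unfolding img by auto
    moreover have "x \<noteq> F k" using x k by auto
    ultimately have "(v, ?g x) \<in> P" by simp
    then show ?thesis
      using d_config_between[OF g, of "A k" x v] x v k by auto
  qed
  then have "d_config k k (?h(A k := w))"
    using d_config_swap_bottom[OF g z(1)] by blast
  then show False using DMD_config[OF D z(1)] w by simp
qed

text \<open>Induction down the \<open>A\<close> chain. At \<open>A 3\<close>, \<open>NTC\<close>
  leaves only \<open>h B\<close> and \<open>h C\<close>. Further down, \<open>VT\<close> gives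
  \<open>x\<close> and \<open>h (A j)\<close> a common cover \<open>t\<close>, which is in the image
  by induction, and convexity captures \<open>x\<close>.\<close>

lemma A_covers_in_d_config:
  assumes "VT P" "NTC P" and h: "d_config n m h"
  shows "3 \<le> j \<Longrightarrow> j \<le> n \<Longrightarrow> covby P (h (A j)) x \<Longrightarrow> x \<in> h ` verts n m"
proof (induction j arbitrary: x rule: dec_induct)
  case base
  have "covby P (h (A 3)) (h B)" "covby P (h (A 3)) (h C)" "h B \<noteq> h C"
    using d_config_cover_map[OF h] d_config_eq_iff[OF h, of B C] by (auto simp: cover_map_def)
  then have "x = h B \<or> x = h C" using \<open>NTC P\<close> base unfolding NTC_def by blast
  then show ?case by auto
next
  case (step j)
  have j: "covby P (h (A (Suc j))) (h (A j))"
    using d_config_cover_map[OF h] step by (auto simp: cover_map_def)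
  show ?case
  proof (cases "x = h (A j)")
    case True
    then show ?thesis using step by auto
  next
    case False
    then obtain t where t: "covby P x t" "covby P (h (A j)) t"
      using j step.prems(2) \<open>VT P\<close> unfolding VT_def by blast
    then obtain y where y: "y \<in> verts n m" "t = h y" using step by auto
    then have "\<exists>y\<in>verts n m. x = h y \<and> d_le (A (Suc j)) y \<and> d_le y y"
      using d_config_between[OF h, of "A (Suc j)" y x] step t covby_le
      by auto
    then show ?thesis by blast
  qed
qed

lemma NODm_if_VT_DmC_DMD_NTC:
  assumes k: "3 \<le> k" and "VT P" "DmC k P" "NTC P" and D: "DMD k P"
  shows "NODm k P"
  unfolding NODm_iff[OF k]
proof
  assume "\<exists>h w. d_config k (k - 1) h \<and> d_config k (k - 1) (h(A k := w)) \<and> w \<noteq> h (A k)"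
  then obtain h w where h: "d_config k (k - 1) h" and g: "d_config k (k - 1) (h(A k := w))"
    and w: "w \<noteq> h (A k)" by blast
  have "d_minus_set k P (h ` verts k (k - 1))" using d_minus_set_iff[OF k] h by blast
  then obtain z where "d_interval k P (h ` verts k (k - 1) \<union> {z})"
    using \<open>DmC k P\<close> unfolding DmC_def by blast
  then have z: "d_config k k (h(F k := z))"
    using d_interval_insert_completing[OF h] completing_iff[OF h] by blast
  let ?h = "h(F k := z)" and ?g = "h(A k := w)"
  \<comment> \<open>The first cover \<open>x\<close> of \<open>w\<close> towards \<open>v\<close>
    lies in the second set and, not being its bottom, also in the first. Convexity of the completed
    first set captures \<open>v\<close>, which is above \<open>x\<close> and so not
    \<open>h (A k)\<close>.\<close>
  have "v \<in> ?g ` verts k (k - 1)" if v: "(w, v) \<in> P" "(v, z) \<in> P" "v \<noteq> w" "v \<noteq> z" for v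
  proof -
    obtain x where x: "covby P w x" "(x, v) \<in> P" using ex_upper_cover v by blast
    then have "x \<in> ?g ` verts k (k - 1)"
      using A_covers_in_d_config[OF \<open>VT P\<close> \<open>NTC P\<close> g, of k x] k by simp
    then obtain y where y: "y \<in> verts k (k - 1)" "x = ?g y" by blast
    have "y \<noteq> A k" "y \<noteq> F k" using x y k by (auto simp: covby_def)
    then have "(?h y, v) \<in> P" "y \<in> verts k k" "\<not> d_le y (A k)"
      using x(2) y verts_insert_top[OF k] by (auto, cases y, auto)
    then obtain y' where y': "y' \<in> verts k k" "v = ?h y'" "d_le y y'"
      using d_config_between[OF z, of y "F k" v] v k by auto
    have "y' \<noteq> A k" using y'(3) \<open>\<not> d_le y (A k)\<close> by blast
    moreover have "y' \<noteq> F k" using v(4) y'(2) by auto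
    ultimately show ?thesis using y' verts_insert_top[OF k] by auto
  qed
  then have "d_config k k (?h(A k := w))"
    using d_config_swap_bottom[OF g z] by blast
  then show False using DMD_config[OF D z] w by simp
qed

section \<open>Covers of the maximum under unique completion: (b)\<close>

text \<open>Without its maximum the interval is a d_k^- set. By \<open>UC\<close> the maximum is the
  completing element that \<open>DmCF\<close> provides, and that one covers only elements of the
  set.\<close>

lemma DMF_if_DmCF_UC:
  assumes k: "3 \<le> k" and "DmCF k P" "UC k P"
  shows "DMF k P"
  unfolding DMF_def
proof (intro allI impI)
  fix S m x
  assume a: "d_interval k P S \<and> maximum_of P S m" and x: "covby P x m"
  then obtain h where h: "d_config k k h" "S = h ` verts k k" using d_interval_iff[OF k] by blast
  then have m: "m = h (F k)" using a d_config_maximum_iff by blast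
  have h': "d_config k (k - 1) h" using d_config_restrict[OF h(1)] k by simp
  obtain z where z: "d_config k k (h(F k := z))" "\<And>x. covby P x z \<Longrightarrow> x \<in> h ` verts k (k - 1)"
    using DmCF_config[OF \<open>DmCF k P\<close> h'] by blast
  have "completing k P (h ` verts k (k - 1)) z" using completing_iff[OF h'] z by blast
  moreover have "completing k P (h ` verts k (k - 1)) m" using completing_config[OF h(1)] m by simp
  moreover have "d_minus_set k P (h ` verts k (k - 1))" using d_minus_set_iff[OF k] h' by blast
  ultimately have "z = m" using \<open>UC k P\<close> unfolding UC_def by blast
  then show "x \<in> S" using z x h(2) verts_insert_top[OF k] by blast
qed

lemma DMF_config:
  assumes "DMF k P" "d_config k k h" "covby P x (h (F k))"
  shows "x \<in> h ` verts k k"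
proof -
  have k: "3 \<le> k" using assms(2) by (simp add: d_config_def)
  have "d_interval k P (h ` verts k k)" using d_interval_iff[OF k] assms(2) by blast
  moreover have "maximum_of P (h ` verts k k) (h (F k))"
    using d_config_maximum_iff[OF assms(2)] by simp
  ultimately show ?thesis using assms(1,3) unfolding DMF_def by blast
qed

section \<open>Two d_k-intervals with a common maximum: (e)\<close>

lemma DMD_if_DMF_NODm:
  assumes k: "3 \<le> k" and DMF: "\<And>j. 3 \<le> j \<Longrightarrow> j \<le> k \<Longrightarrow> DMF j P"
    and NOD: "\<And>j. 3 \<le> j \<Longrightarrow> j \<le> k \<Longrightarrow> NODm j P"
  shows "DMD k P"
  unfolding DMD_def
proof (intro allI impI notI)
  fix S T m n
  assume a: "d_interval k P S \<and> d_interval k P T \<and> S \<noteq> T \<and> maximum_of P S m \<and> maximum_of P T n"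
    and mn: "m = n"
  obtain h where h: "d_config k k h" "S = h ` verts k k" using a d_interval_iff[OF k] by auto
  obtain g where g: "d_config k k g" "T = g ` verts k k" using a d_interval_iff[OF k] by auto
  have top: "g (F k) = h (F k)"
    using a mn d_config_maximum_iff[OF h(1)] d_config_maximum_iff[OF g(1)] h(2) g(2) by auto
  have FF: "3 \<le> i \<longrightarrow> g (F i) = h (F i)" if "i \<le> k" for i
    using that
  proof (induction i rule: inc_induct)
    case base
    show ?case using top by simp
  next
    case (step i)
    show ?case
    proof
      assume i: "3 \<le> i"
      \<comment> \<open>Cut down to \<open>Suc i\<close> at both ends, \<open>h\<close> has the
        maximum \<open>h (F (Suc i))\<close>, so \<open>DMF\<close> applies there; within this part
        only \<open>F i\<close> is covered by the maximum.\<close>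
      have hs: "d_config (Suc i) (Suc i) h" using d_config_restrict[OF h(1)] step i by simp
      have c: "covby P (g (F i)) (h (F (Suc i)))"
        using d_config_cover_map[OF g(1)] step i by (auto simp: cover_map_def)
      then obtain x where x: "x \<in> verts (Suc i) (Suc i)" "g (F i) = h x"
        using DMF_config[OF DMF hs] i step by auto
      then have "d_le x (F (Suc i)) \<and> x \<noteq> F (Suc i) \<and>
          (\<forall>z\<in>verts (Suc i) (Suc i). d_le x z \<and> d_le z (F (Suc i)) \<longrightarrow> z = x \<or> z = F (Suc i))"
        using d_config_covby[OF hs x(1), of "F (Suc i)"] c i by auto
      then have "x = F i" using x(1) i by (cases x) (auto dest: bspec[of _ _ "F i"])
      then show "g (F i) = h (F i)" using x by simp
    qed
  qed
  have h3: "d_config 3 3 h" using d_config_restrict[OF h(1)] k by simp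
  \<comment> \<open>The same argument at \<open>F 3\<close>, which covers two vertices;
    \<open>g\<close> may interchange them, so only the pairs agree.\<close>
  have BC: "g X \<in> {h B, h C}" if X: "X \<in> {B, C}" for X
  proof -
    have c: "covby P (g X) (h (F 3))"
      using d_config_cover_map[OF g(1)] X k FF[of 3] by (auto simp: cover_map_def)
    then obtain x where x: "x \<in> verts 3 3" "g X = h x"
      using DMF_config[OF DMF h3] k by auto
    then have "d_le x (F 3) \<and> x \<noteq> F 3 \<and> (\<forall>z\<in>verts 3 3. d_le x z \<and> d_le z (F 3) \<longrightarrow> z = x \<or> z = F 3)"
      using d_config_covby[OF h3 x(1), of "F 3"] c by auto
    then have "x = B \<or> x = C" using x(1) by (cases x) (auto dest: bspec[of _ _ B])
    then show ?thesis using x by auto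
  qed
  have "g B \<noteq> g C" using d_config_eq_iff[OF g(1), of B C] by simp
  then have BC: "{g B, g C} = {h B, h C}" using BC[of B] BC[of C] by auto
  have AA: "g (A i) = h (A i)" if "3 \<le> i" "i \<le> k" for i
    using that
  proof (induction i rule: less_induct)
    case (less i)
    \<comment> \<open>In \<open>g\<close> the roles of \<open>B\<close> and \<open>C\<close> may be
      interchanged. The map \<open>?h\<close> keeps those of \<open>h\<close>, has the same image as
      \<open>g\<close> on \<open>verts i (i - 1)\<close>, and differs from \<open>h\<close> at most
      in the bottom, so \<open>NODm\<close> applies.\<close>
    let ?h = "h(A i := g (A i))"
    have hi: "d_config i (i - 1) h" and gi: "d_config i (i - 1) g"
      using d_config_restrict[OF h(1)] d_config_restrict[OF g(1)] less.prems by simp_all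
    have "?h ` verts i (i - 1) = ?h ` A ` {3..i} \<union> {h B, h C} \<union> ?h ` F ` {3..i - 1}"
      by (auto simp: verts_def)
    also have "?h ` A ` {3..i} = g ` A ` {3..i}"
      unfolding image_image using less by (intro image_cong) auto
    also have "?h ` F ` {3..i - 1} = g ` F ` {3..i - 1}"
      unfolding image_image using less.prems FF by (intro image_cong) auto
    also have "{h B, h C} = {g B, g C}" using BC ..
    also have "g ` A ` {3..i} \<union> {g B, g C} \<union> g ` F ` {3..i - 1} = g ` verts i (i - 1)"
      by (auto simp: verts_def)
    finally have img: "?h ` verts i (i - 1) = g ` verts i (i - 1)" .
    have "covby P (?h (A (Suc j))) (?h (A j))" if "3 \<le> j \<and> j < i" for j
      using d_config_cover_map[OF gi] less that by (auto simp: cover_map_def)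
    moreover have "covby P (g (A 3)) (h B)" "covby P (g (A 3)) (h C)"
      using d_config_cover_map[OF gi] BC unfolding cover_map_def by (metis empty_iff insert_iff)+
    moreover have "h B \<noteq> h C" using d_config_eq_iff[OF hi, of B C] by simp
    ultimately have "d_emb (verts i (i - 1)) ?h"
      using d_config_cover_map[OF hi] by (intro cover_map_emb) (auto simp: cover_map_def)
    then have "d_config i (i - 1) ?h"
      using gi unfolding d_config_def img by blast
    then show ?case using NOD[OF less.prems] hi NODm_iff[OF less.prems(1)] by blast
  qed
  have "h ` verts k k = h ` A ` {3..k} \<union> {h B, h C} \<union> h ` F ` {3..k}"
    by (auto simp: verts_def)
  also have "h ` A ` {3..k} = g ` A ` {3..k}"
    unfolding image_image using AA by (intro image_cong) auto
  also have "h ` F ` {3..k} = g ` F ` {3..k}"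
    unfolding image_image using FF by (intro image_cong) auto
  also have "{h B, h C} = {g B, g C}" using BC ..
  also have "g ` A ` {3..k} \<union> {g B, g C} \<union> g ` F ` {3..k} = g ` verts k k"
    by (auto simp: verts_def)
  finally show False using a h g by blast
qed

section \<open>Uniqueness of completing elements: (f)\<close>

text \<open>
  In the proof, \<open>b X i\<close> is the element of \<open>S\<close> that takes the role of \<open>A i\<close> in the configurations
  above \<open>S\<close>; the bottom one, \<open>b X k\<close>, is either of the two incomparable elements of \<open>S\<close>.
\<close>

lemma unique_completing:
  assumes DmCF: "\<And>j. 3 \<le> j \<Longrightarrow> j \<le> k \<Longrightarrow> DmCF j P" and NOD: "NODm k P"
    and z1: "d_config k k (h(F k := z1))" and z2: "d_config k k (h(F k := z2))"
  shows "z1 = z2"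
proof (rule ccontr)
  assume ne: "z1 \<noteq> z2"
  have k: "3 \<le> k" using z1 by (simp add: d_config_def)
  \<comment> \<open>The index \<open>k + 2 - i\<close> reverses the chain: for \<open>k > 3\<close>,
    \<open>i = 3\<close> gives \<open>F (k - 1)\<close>, just below \<open>z1\<close> and
    \<open>z2\<close>, and \<open>i = k - 1\<close> gives \<open>F 3\<close>.\<close>
  define b where "b X i = (if i = k then h X else h (F (k + 2 - i)))" for X i
  \<comment> \<open>The two completing elements become the incomparable pair; \<open>p\<close> is
    the upper chain still to be built.\<close>
  define G where "G X p v = (case v of A i \<Rightarrow> b X i | B \<Rightarrow> z1 | C \<Rightarrow> z2 | F i \<Rightarrow> p i)"
    for X v and p :: "nat \<Rightarrow> 'a"
  have G [simp]: "G X p (A i) = b X i" "G X p B = z1" "G X p C = z2" "G X p (F i) = p i" for X p i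
    by (simp_all add: G_def)
  have cov1: "covby P (b X 3) z" if z: "d_config k k (h(F k := z))" and X: "X \<in> {B, C}" for X z
  proof (cases "k = 3")
    case True
    then show ?thesis using d_config_cover_map[OF z] X by (auto simp: b_def cover_map_def)
  next
    case False
    then have "3 \<le> k - 1" "k - 1 < k" using k by auto
    then have "covby P ((h(F k := z)) (F (k - 1))) ((h(F k := z)) (F (Suc (k - 1))))"
      using d_config_cover_map[OF z] unfolding cover_map_def by blast
    then show ?thesis using False k by (auto simp: b_def split: if_splits)
  qed
  have cov2: "covby P (b X (Suc i)) (b X i)" if "3 \<le> i" "i < k" "X \<in> {B, C}" for X i
  proof (cases "Suc i = k")
    case True
    then have "k + 2 - i = 3" "k \<noteq> 3" "i \<noteq> k" using that by auto
    then show ?thesis using d_config_cover_map[OF z1] that True by (auto simp: b_def cover_map_def)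
  next
    case False
    define l where "l = k + 2 - Suc i"
    have l: "3 \<le> l" "l < k" "Suc l = k + 2 - i" "Suc l \<noteq> k" "i \<noteq> k"
      using that False by (auto simp: l_def)
    then have "covby P ((h(F k := z1)) (F l)) ((h(F k := z1)) (F (Suc l)))"
      using d_config_cover_map[OF z1] unfolding cover_map_def by blast
    moreover have "Suc k - i = l" by (simp add: l_def)
    ultimately show ?thesis using l False by (simp add: b_def)
  qed
  \<comment> \<open>Between \<open>b X i\<close> and \<open>z\<close> there is only a chain, since
    at most one of \<open>B\<close> and \<open>C\<close> occurs there.\<close>
  have up: "v = z \<or> (\<exists>j. 3 \<le> j \<and> j \<le> i \<and> v = b X j)"
    if z: "d_config k k (h(F k := z))" and v: "(b X i, v) \<in> P" "(v, z) \<in> P"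
      and i: "3 \<le> i" "i \<le> k" and X: "X \<in> {B, C}" for X z i v
  proof -
    define x where "x = (if i = k then X else F (k + 2 - i))"
    have x: "x \<in> verts k k" "b X i = (h(F k := z)) x"
      using X i by (auto simp: x_def b_def)
    then have "\<exists>y\<in>verts k k. v = (h(F k := z)) y \<and> d_le x y \<and> d_le y (F k)"
      using d_config_between[OF z x(1), of "F k" v] v k by simp
    then obtain y where y: "y \<in> verts k k" "v = (h(F k := z)) y" "d_le x y" by blast
    show ?thesis
    proof (cases "y = X \<or> y = F k")
      case True
      then show ?thesis
      proof
        assume "y = X"
        then have "i = k" "v = b X k" using X y by (auto simp: x_def b_def split: if_splits)
        then show ?thesis using i by auto
      qed (use y in simp)
    next
      case False
      then obtain l where l: "y = F l" using y(3) X by (cases y) (auto simp: x_def split: if_splits)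
      then have "3 \<le> l" "l < k" using y(1) False by auto
      moreover have "k + 2 - i \<le> l" using l y(3) \<open>3 \<le> l\<close> by (auto simp: x_def split: if_splits)
      ultimately have "3 \<le> k + 2 - l \<and> k + 2 - l \<le> i \<and> v = b X (k + 2 - l)"
        using l y(2) i by (auto simp: b_def)
      then show ?thesis by blast
    qed
  qed
  \<comment> \<open>The second conjunct bounds what lies below the new chain; together with
    \<open>up\<close> it yields convexity when a vertex is added at each end.\<close>
  have step: "\<exists>p. (\<forall>X\<in>{B, C}. d_config j (j - 1) (G X p)) \<and>
    (\<forall>i v. 3 \<le> i \<and> i \<le> j - 1 \<and> (v, p i) \<in> P \<longrightarrow>
      (v, z1) \<in> P \<or> (v, z2) \<in> P \<or> (\<exists>l. 3 \<le> l \<and> l \<le> j - 1 \<and> v = p l))"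
    if "3 \<le> j" "j \<le> k" for j
    using that
  proof (induction j rule: dec_induct)
    case base
    \<comment> \<open>For \<open>j = 3\<close> the index range of \<open>p\<close> is empty, so any
      value serves.\<close>
    have "d_config 3 2 (G X undefined)" if "X \<in> {B, C}" for X
      using cov1[OF z1 that] cov1[OF z2 that] ne by (simp add: d_config_3_2_iff)
    then show ?case by (intro exI[of _ undefined]) auto
  next
    case (step j)
    then obtain p where p: "\<And>X. X \<in> {B, C} \<Longrightarrow> d_config j (j - 1) (G X p)"
      and below: "\<And>i v. 3 \<le> i \<Longrightarrow> i \<le> j - 1 \<Longrightarrow> (v, p i) \<in> P \<Longrightarrow>
        (v, z1) \<in> P \<or> (v, z2) \<in> P \<or> (\<exists>l. 3 \<le> l \<and> l \<le> j - 1 \<and> v = p l)"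
      by auto
    have jk: "3 \<le> j" "j < k" using step by auto
    \<comment> \<open>For \<open>j < k\<close> the values \<open>b X i\<close> with
      \<open>i \<le> j\<close> do not depend on \<open>X\<close>, so completing the set for
      \<open>B\<close> serves both choices.\<close>
    obtain z where z: "d_config j j ((G B p)(F j := z))"
      "\<And>x. covby P x z \<Longrightarrow> x \<in> G B p ` verts j (j - 1)"
      using DmCF_config[OF DmCF[of j] p[of B]] jk by auto
    define q where "q = p(j := z)"
    have "(G B p)(F j := z) = G B q"
    proof
      fix v show "((G B p)(F j := z)) v = G B q v" by (cases v) (auto simp: q_def)
    qed
    then have q: "d_config j j (G B q)" using z(1) by simp
    have qp: "q i = p i" if "i \<le> j - 1" for i using that jk by (auto simp: q_def)
    have below': "(v, z1) \<in> P \<or> (v, z2) \<in> P \<or> (\<exists>l. 3 \<le> l \<and> l \<le> j \<and> v = q l)"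
      if i: "3 \<le> i" "i \<le> j" and v: "(v, q i) \<in> P" for i v
    proof -
      have *: "(v, z1) \<in> P \<or> (v, z2) \<in> P \<or> (\<exists>l. 3 \<le> l \<and> l \<le> j \<and> v = q l)"
        if "3 \<le> i" "i \<le> j - 1" "(v, p i) \<in> P" for i
      proof -
        have "\<exists>l. 3 \<le> l \<and> l \<le> j \<and> v = q l" if "3 \<le> l \<and> l \<le> j - 1 \<and> v = p l" for l
          using that qp[of l] by (intro exI[of _ l]) auto
        then show ?thesis using below[OF that] by blast
      qed
      show ?thesis
      proof (cases "i = j")
        case False
        then show ?thesis using *[of i] v i qp[of i] by simp
      next
        case True
        show ?thesis
        proof (cases "v = z")
          case True
          then show ?thesis using jk by (auto simp: q_def)
        next
          case False
          \<comment> \<open>Since \<open>z\<close> covers only elements of the previous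
            configuration, passing to a lower cover of \<open>z\<close> above \<open>v\<close>
            reduces the claim to that configuration.\<close>
          have "(v, z) \<in> P" using v True by (simp add: q_def)
          then obtain x where x: "(v, x) \<in> P" "covby P x z" using False ex_lower_cover by blast
          then obtain y where y: "y \<in> verts j (j - 1)" "x = G B p y" using z(2) by blast
          show ?thesis
          proof (cases y)
            case (A l)
            then have "(x, z1) \<in> P"
              using d_config_le_iff[OF p[of B], of y B] y by simp
            then show ?thesis using x P_trans by blast
          qed (use x y *  in auto)
        qed
      qed
    qed
    have "d_config (Suc j) j (G X q)" if X: "X \<in> {B, C}" for X
    proof -
      have "cover_map (Suc j) j (G X q)"
        using d_config_cover_map[OF q] cov1[OF z1 X] cov1[OF z2 X] cov2 X jk
        unfolding cover_map_def by simp
      \<comment> \<open>If \<open>v\<close> is below \<open>z1\<close> or \<open>z2\<close>,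
        \<open>up\<close> places it there or on the chain of the \<open>b X l\<close>; otherwise
        \<open>below'\<close> places it on the new chain.\<close>
      moreover have "v \<in> G X q ` verts (Suc j) j" if v: "(b X (Suc j), v) \<in> P" "(v, q j) \<in> P" for v
      proof -
        have "(v, z1) \<in> P \<or> (v, z2) \<in> P \<or> (\<exists>l. 3 \<le> l \<and> l \<le> j \<and> v = q l)"
          using below'[of j v] v(2) jk by simp
        then have "v = z1 \<or> v = z2 \<or> (\<exists>l. 3 \<le> l \<and> l \<le> Suc j \<and> v = b X l) \<or>
            (\<exists>l. 3 \<le> l \<and> l \<le> j \<and> v = q l)"
          using up[OF z1 v(1) _ _ _ X] up[OF z2 v(1) _ _ _ X] jk by auto
        moreover have "z1 \<in> G X q ` verts (Suc j) j" "z2 \<in> G X q ` verts (Suc j) j"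
          using imageI[of B "verts (Suc j) j" "G X q"] imageI[of C "verts (Suc j) j" "G X q"] by simp_all
        moreover have "b X l \<in> G X q ` verts (Suc j) j" if "3 \<le> l \<and> l \<le> Suc j" for l
          using imageI[of "A l" "verts (Suc j) j" "G X q"] that by simp
        moreover have "q l \<in> G X q ` verts (Suc j) j" if "3 \<le> l \<and> l \<le> j" for l
          using imageI[of "F l" "verts (Suc j) j" "G X q"] that by simp
        ultimately show ?thesis by metis
      qed
      ultimately show ?thesis
        using ne jk by (intro d_config_intro_interval) (auto simp: interval_def)
    qed
    then show ?case using below' by (intro exI[of _ q]) auto
  qed
  obtain p where p: "\<And>X. X \<in> {B, C} \<Longrightarrow> d_config k (k - 1) (G X p)"
    using step[of k] k by auto
  \<comment> \<open>At \<open>j = k\<close> the two configurations differ only in the bottom,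
    \<open>h B\<close> against \<open>h C\<close>, so they overlap.\<close>
  have "G C p x = ((G B p)(A k := h C)) x" for x
    by (cases x) (auto simp: b_def)
  then have "G C p = (G B p)(A k := h C)" by blast
  then have "d_config k (k - 1) ((G B p)(A k := h C))" using p[of C] by simp
  then have "h C = G B p (A k)" using p[of B] NOD unfolding NODm_iff[OF k] by blast
  then show False using d_config_eq_iff[OF z1, of B C] by (simp add: b_def)
qed

lemma UC_if_DmCF_NODm:
  assumes k: "3 \<le> k" and DmCF: "\<And>j. 3 \<le> j \<Longrightarrow> j \<le> k \<Longrightarrow> DmCF j P" and NOD: "NODm k P"
  shows "UC k P"
  unfolding UC_def
proof (intro allI impI)
  fix S assume "d_minus_set k P S"
  then obtain h where h: "d_config k (k - 1) h" and S: "S = h ` verts k (k - 1)"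
    using d_minus_set_iff[OF k] by auto
  obtain z where "d_config k k (h(F k := z))"
    using DmCF_config[OF DmCF[OF k order_refl] h] by blast
  then show "\<exists>!z. completing k P S z"
    unfolding S completing_iff[OF h] using unique_completing[OF DmCF NOD] by blast
qed

end

theorem theorem7p5:
  fixes P :: "'a rel" and k :: nat
  assumes "3 \<le> k" and "Partial_order P" and "locally_finite P"
  shows
    "(VT P \<and> DmC k P \<and> DMD k P \<and> NTC P \<longrightarrow> NODm k P) \<and>
     (DmCF k P \<and> UC k P \<longrightarrow> DmC k P \<and> DMF k P) \<and>
     (DmCF k P \<and> DMD k P \<longrightarrow> NODm k P) \<and>
     ((\<forall>h. 3 \<le> h \<and> h \<le> k \<longrightarrow> DmCF h P \<and> NODm h P) \<longrightarrow> DMD k P) \<and>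
     ((\<forall>h. 3 \<le> h \<and> h \<le> k \<longrightarrow> DMF h P \<and> NODm h P) \<longrightarrow> DMD k P) \<and>
     ((\<forall>h. 3 \<le> h \<and> h \<le> k \<longrightarrow> DmCF h P) \<and> NODm k P \<longrightarrow> UC k P \<and> DMF k P)"
proof -
  interpret lf_poset P using assms by unfold_locales
  \<comment> \<open>Stated for every \<open>j\<close>, since (d) needs \<open>DMF\<close> at all
    levels up to \<open>k\<close> before (e) applies.\<close>
  have uc: "UC j P" and mf: "DMF j P"
    if "3 \<le> j" "\<And>h. 3 \<le> h \<Longrightarrow> h \<le> j \<Longrightarrow> DmCF h P" "NODm j P" for j
  proof -
    show "UC j P" using UC_if_DmCF_NODm that by blast
    then show "DMF j P" using DMF_if_DmCF_UC that by blast
  qed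
  have md: "DMD k P" if "\<And>h. 3 \<le> h \<Longrightarrow> h \<le> k \<Longrightarrow> DMF h P \<and> NODm h P"
    using DMD_if_DMF_NODm[OF assms(1)] that by blast
  have "DmC k P" if "DmCF k P" using that unfolding DmC_def DmCF_def by blast
  moreover have "DMD k P" if "\<And>h. 3 \<le> h \<Longrightarrow> h \<le> k \<Longrightarrow> DmCF h P \<and> NODm h P"
    using that by (intro md conjI mf) auto
  ultimately show ?thesis
    using assms(1) uc[of k] mf[of k] md NODm_if_VT_DmC_DMD_NTC DMF_if_DmCF_UC NODm_if_DmCF_DMD
    by (intro conjI impI) simp_all
qed

end
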